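(* Let $\mathbf{k}$ be a commutative unital ring, $\lambda\in\mathbf{k}$, and $n\ge 1$. For $r=\sum_i u_i\otimes v_i\in M_n(\mathbf{k})\otimes M_n(\mathbf{k})$ let $P_r:M_n(\mathbf{k})\to M_n(\mathbf{k})$ be the linear operator $P_r(a)=\sum_i u_i a v_i$. Then the map $r\mapsto P_r$ is a bijection between the set of solutions of the associative Yang-Baxter equation of weight $\lambda$ in $M_n(\mathbf{k})$ and the set of Rota-Baxter operators of weight $-\lambda$ on $M_n(\mathbf{k})$.
   Context: Tensor products are over $\mathbf{k}$, and $M_n(\mathbf{k})$ is the unital algebra of $n\times n$ matrices over $\mathbf{k}$. For a unital algebra $A$ and $r=\sum_i u_i\otimes v_i\in A\otimes A$, set $r_{12}=\sum_i u_i\otimes v_i\otimes 1$, $r_{13}=\sum_i u_i\otimes 1\otimes v_i$, $r_{23}=\sum_i 1\otimes u_i\otimes v_i$ in the tensor product algebra $A\otimes A\otimes A$. The element $r$ is a solution of the associative Yang-Baxter equation (AYBE) of weight $\lambda$ in $A$ if $r_{13}r_{12}-r_{12}r_{23}+r_{23}r_{13}=\lambda r_{13}$. A Rota-Baxter operator of weight $\mu\in\mathbf{k}$ on $A$ is a $\mathbf{k}$-linear map $P:A\to A$ with $P(a)P(b)=P(aP(b))+P(P(a)b)+\mu P(ab)$ for all $a,b\in A$. *)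

theory Defs
  imports
    "Jordan_Normal_Form.Matrix"
    "HOL-Algebra.Free_Abelian_Groups"
    "HOL-Algebra.QuotRing"
begin

text \<open>
  An algebra over \<open>'k\<close> is given by a record of type \<open>('k, 'a) module\<close>, whose fields include both
  a ring structure and a scalar multiplication by all elements of the type \<open>'k\<close>.

  Commutative unital rings are the types of sort \<open>{comm_ring, comm_monoid_mult}\<close>. The class
  \<open>comm_ring_1\<close> would additionally impose \<open>0 \<noteq> 1\<close>; for the same reason the library constant
  \<open>module_mat\<close>, which requires \<open>semiring_1\<close>, is replaced by the following one.
\<close>

definition mat_algebra :: "nat \<Rightarrow> ('k::{comm_ring, comm_monoid_mult}, 'k mat) module" where
  "mat_algebra n = \<lparr>
     carrier = carrier_mat n n,
     mult = (*),
     one = 1\<^sub>m n,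
     ring.zero = 0\<^sub>m n n,
     add = (+),
     smult = (\<cdot>\<^sub>m)\<rparr>"

subsection \<open>Tensor products\<close>

text \<open>
  \<open>A \<otimes>\<^sub>k B\<close> is the quotient of the free abelian group on \<open>A \<times> B\<close> by the subgroup generated by the
  biadditivity relations and the balancing relations \<open>(c a, b) - (a, c b)\<close>; scalars act through the
  first factor. The elements of the tensor product are the cosets.
\<close>

abbreviation tensor_free ::
  "('k, 'a) module \<Rightarrow> ('k, 'b) module \<Rightarrow> ('a \<times> 'b \<Rightarrow>\<^sub>0 int) monoid" where
  "tensor_free A B \<equiv> free_Abelian_group (carrier A \<times> carrier B)"

definition tensor_relators ::
  "('k, 'a) module \<Rightarrow> ('k, 'b) module \<Rightarrow> ('a \<times> 'b \<Rightarrow>\<^sub>0 int) set" where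
  "tensor_relators A B =
     {frag_of (a \<oplus>\<^bsub>A\<^esub> a', b) - frag_of (a, b) - frag_of (a', b) | a a' b.
        a \<in> carrier A \<and> a' \<in> carrier A \<and> b \<in> carrier B}
   \<union> {frag_of (a, b \<oplus>\<^bsub>B\<^esub> b') - frag_of (a, b) - frag_of (a, b') | a b b'.
        a \<in> carrier A \<and> b \<in> carrier B \<and> b' \<in> carrier B}
   \<union> {frag_of (c \<odot>\<^bsub>A\<^esub> a, b) - frag_of (a, c \<odot>\<^bsub>B\<^esub> b) | a b c.
        a \<in> carrier A \<and> b \<in> carrier B}"

definition tensor_kernel ::
  "('k, 'a) module \<Rightarrow> ('k, 'b) module \<Rightarrow> ('a \<times> 'b \<Rightarrow>\<^sub>0 int) set" where
  "tensor_kernel A B = generate (tensor_free A B) (tensor_relators A B)"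

definition tensor_coset ::
  "('k, 'a) module \<Rightarrow> ('k, 'b) module \<Rightarrow> ('a \<times> 'b \<Rightarrow>\<^sub>0 int) \<Rightarrow> ('a \<times> 'b \<Rightarrow>\<^sub>0 int) set" where
  "tensor_coset A B x = tensor_kernel A B #>\<^bsub>tensor_free A B\<^esub> x"

definition pure_tensor ::
  "('k, 'a) module \<Rightarrow> ('k, 'b) module \<Rightarrow> 'a \<Rightarrow> 'b \<Rightarrow> ('a \<times> 'b \<Rightarrow>\<^sub>0 int) set" where
  "pure_tensor A B a b = tensor_coset A B (frag_of (a, b))"

definition tensor_free_mult ::
  "('k, 'a) module \<Rightarrow> ('k, 'b) module \<Rightarrow>
     ('a \<times> 'b \<Rightarrow>\<^sub>0 int) \<Rightarrow> ('a \<times> 'b \<Rightarrow>\<^sub>0 int) \<Rightarrow> ('a \<times> 'b \<Rightarrow>\<^sub>0 int)" where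
  "tensor_free_mult A B x y =
     frag_extend (\<lambda>(a, b). frag_extend (\<lambda>(c, d). frag_of (a \<otimes>\<^bsub>A\<^esub> c, b \<otimes>\<^bsub>B\<^esub> d)) y) x"

definition tensor_free_smult ::
  "('k, 'a) module \<Rightarrow> 'k \<Rightarrow> ('a \<times> 'b \<Rightarrow>\<^sub>0 int) \<Rightarrow> ('a \<times> 'b \<Rightarrow>\<^sub>0 int)" where
  "tensor_free_smult A c x = frag_extend (\<lambda>(a, b). frag_of (c \<odot>\<^bsub>A\<^esub> a, b)) x"

text \<open>
  Operations on cosets are unions over representatives, as for \<^const>\<open>rcoset_mult\<close>; all the cosets
  in these unions coincide when \<open>A\<close> and \<open>B\<close> are algebras.
\<close>

definition tensor_algebra ::
  "('k, 'a) module \<Rightarrow> ('k, 'b) module \<Rightarrow> ('k, ('a \<times> 'b \<Rightarrow>\<^sub>0 int) set) module" where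
  "tensor_algebra A B = \<lparr>
     carrier = carrier (tensor_free A B Mod tensor_kernel A B),
     mult = (\<lambda>U V. \<Union>x\<in>U. \<Union>y\<in>V. tensor_coset A B (tensor_free_mult A B x y)),
     one = pure_tensor A B \<one>\<^bsub>A\<^esub> \<one>\<^bsub>B\<^esub>,
     ring.zero = \<one>\<^bsub>tensor_free A B Mod tensor_kernel A B\<^esub>,
     add = (\<lambda>U V. U \<otimes>\<^bsub>tensor_free A B Mod tensor_kernel A B\<^esub> V),
     smult = (\<lambda>c U. \<Union>x\<in>U. tensor_coset A B (tensor_free_smult A c x))\<rparr>"

text \<open>
  For \<open>r = \<Sum>\<^sub>i u\<^sub>i \<otimes> v\<^sub>i\<close> in \<open>A \<otimes> B\<close>, the element \<open>\<Sum>\<^sub>i \<phi> u\<^sub>i v\<^sub>i\<close> of \<open>T\<close>. It does not depend on the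
  presentation of \<open>r\<close> whenever \<open>\<phi>\<close> is bilinear, which is the case in all uses below.
\<close>

definition tensor_eval ::
  "('k, 'a) module \<Rightarrow> ('k, 'b) module \<Rightarrow> ('k, 't) module \<Rightarrow>
     ('a \<Rightarrow> 'b \<Rightarrow> 't) \<Rightarrow> ('a \<times> 'b \<Rightarrow>\<^sub>0 int) set \<Rightarrow> 't" where
  "tensor_eval A B T \<phi> r = (THE t. \<exists>(m::nat) u v.
      u \<in> {..<m} \<rightarrow> carrier A \<and> v \<in> {..<m} \<rightarrow> carrier B \<and>
      r = (\<Oplus>\<^bsub>tensor_algebra A B\<^esub> i \<in> {..<m}. pure_tensor A B (u i) (v i)) \<and>
      t = (\<Oplus>\<^bsub>T\<^esub> i \<in> {..<m}. \<phi> (u i) (v i)))"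

subsection \<open>The associative Yang-Baxter equation and Rota-Baxter operators\<close>

type_synonym 'a tensor2 = "('a \<times> 'a \<Rightarrow>\<^sub>0 int) set"
type_synonym 'a tensor3 = "('a tensor2 \<times> 'a \<Rightarrow>\<^sub>0 int) set"

definition tensor2 :: "('k, 'a) module \<Rightarrow> ('k, 'a tensor2) module" where
  "tensor2 A = tensor_algebra A A"

definition tensor3 :: "('k, 'a) module \<Rightarrow> ('k, 'a tensor3) module" where
  "tensor3 A = tensor_algebra (tensor2 A) A"

definition pure_tensor3 :: "('k, 'a) module \<Rightarrow> 'a \<Rightarrow> 'a \<Rightarrow> 'a \<Rightarrow> 'a tensor3" where
  "pure_tensor3 A a b c = pure_tensor (tensor2 A) A (pure_tensor A A a b) c"

definition leg12 :: "('k, 'a) module \<Rightarrow> 'a tensor2 \<Rightarrow> 'a tensor3" where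
  "leg12 A = tensor_eval A A (tensor3 A) (\<lambda>u v. pure_tensor3 A u v \<one>\<^bsub>A\<^esub>)"

definition leg13 :: "('k, 'a) module \<Rightarrow> 'a tensor2 \<Rightarrow> 'a tensor3" where
  "leg13 A = tensor_eval A A (tensor3 A) (\<lambda>u v. pure_tensor3 A u \<one>\<^bsub>A\<^esub> v)"

definition leg23 :: "('k, 'a) module \<Rightarrow> 'a tensor2 \<Rightarrow> 'a tensor3" where
  "leg23 A = tensor_eval A A (tensor3 A) (\<lambda>u v. pure_tensor3 A \<one>\<^bsub>A\<^esub> u v)"

definition aybe_solutions :: "('k, 'a) module \<Rightarrow> 'k \<Rightarrow> 'a tensor2 set" where
  "aybe_solutions A lam = {r \<in> carrier (tensor2 A).
     leg13 A r \<otimes>\<^bsub>tensor3 A\<^esub> leg12 A r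
       \<ominus>\<^bsub>tensor3 A\<^esub> leg12 A r \<otimes>\<^bsub>tensor3 A\<^esub> leg23 A r
       \<oplus>\<^bsub>tensor3 A\<^esub> leg23 A r \<otimes>\<^bsub>tensor3 A\<^esub> leg13 A r
     = lam \<odot>\<^bsub>tensor3 A\<^esub> leg13 A r}"

text \<open>Maps on a carrier are represented by functions that are \<^const>\<open>undefined\<close> outside it.\<close>

definition linear_endos :: "('k, 'a) module \<Rightarrow> ('a \<Rightarrow> 'a) set" where
  "linear_endos A = {P \<in> carrier A \<rightarrow>\<^sub>E carrier A.
     (\<forall>a \<in> carrier A. \<forall>b \<in> carrier A. P (a \<oplus>\<^bsub>A\<^esub> b) = P a \<oplus>\<^bsub>A\<^esub> P b) \<and>
     (\<forall>c. \<forall>a \<in> carrier A. P (c \<odot>\<^bsub>A\<^esub> a) = c \<odot>\<^bsub>A\<^esub> P a)}"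

definition rota_baxter_operators :: "('k, 'a) module \<Rightarrow> 'k \<Rightarrow> ('a \<Rightarrow> 'a) set" where
  "rota_baxter_operators A \<mu> = {P \<in> linear_endos A.
     \<forall>a \<in> carrier A. \<forall>b \<in> carrier A.
       P a \<otimes>\<^bsub>A\<^esub> P b
       = P (a \<otimes>\<^bsub>A\<^esub> P b) \<oplus>\<^bsub>A\<^esub> P (P a \<otimes>\<^bsub>A\<^esub> b) \<oplus>\<^bsub>A\<^esub> \<mu> \<odot>\<^bsub>A\<^esub> P (a \<otimes>\<^bsub>A\<^esub> b)}"

definition sandwich_operator :: "('k, 'a) module \<Rightarrow> 'a tensor2 \<Rightarrow> 'a \<Rightarrow> 'a" where
  "sandwich_operator A r =
     (\<lambda>a \<in> carrier A. tensor_eval A A A (\<lambda>u v. u \<otimes>\<^bsub>A\<^esub> a \<otimes>\<^bsub>A\<^esub> v) r)"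

end

theory Submission
  imports Defs
begin

text \<open>
  For \<open>a, b\<close> in a unital associative algebra \<open>A\<close> let \<open>\<Phi>\<^sub>a\<^sub>,\<^sub>b\<close> be the linear map
  \<open>A \<otimes> A \<otimes> A \<rightarrow> A\<close> sending \<open>x \<otimes> y \<otimes> z\<close> to \<open>x a y b z\<close>, and let \<open>P = P\<^sub>r\<close>. Then \<open>\<Phi>\<^sub>a\<^sub>,\<^sub>b\<close> sends
  \<open>r\<^sub>1\<^sub>3 r\<^sub>1\<^sub>2\<close>, \<open>r\<^sub>1\<^sub>2 r\<^sub>2\<^sub>3\<close>, \<open>r\<^sub>2\<^sub>3 r\<^sub>1\<^sub>3\<close> and \<open>r\<^sub>1\<^sub>3\<close> to \<open>P (P(a) b)\<close>, \<open>P(a) P(b)\<close>, \<open>P (a P(b))\<close> and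
  \<open>P (a b)\<close>. So the Yang-Baxter equation for \<open>r\<close> becomes the Rota-Baxter equation for \<open>P\<close> under
  all the maps \<open>\<Phi>\<^sub>a\<^sub>,\<^sub>b\<close>. For matrices these maps separate points, since the \<open>(p, q)\<close> entry of
  \<open>x E\<^sub>j\<^sub>k y E\<^sub>l\<^sub>m z\<close> is the coordinate \<open>x\<^sub>p\<^sub>j y\<^sub>k\<^sub>l z\<^sub>m\<^sub>q\<close> of \<open>x \<otimes> y \<otimes> z\<close>; the
  same computation with one factor less shows that \<open>r \<mapsto> P\<^sub>r\<close> is injective.
\<close>

subsection \<open>Tensor products of algebras\<close>

text \<open>These are the axioms that a tensor product inherits from its factors, so the
  construction can be iterated to reach A \<otimes> A \<otimes> A. Associativity and the unit laws
  are added for the base algebra only, in \<open>unital_algebra\<close>.\<close>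

locale bilinear_algebra = abelian_group A
  for A :: "('k::{comm_ring, comm_monoid_mult}, 'a) module" (structure) +
  assumes smult_closed [simp, intro]: "x \<in> carrier A \<Longrightarrow> c \<odot> x \<in> carrier A"
    and smult_add_left: "x \<in> carrier A \<Longrightarrow> (c + d) \<odot> x = c \<odot> x \<oplus> d \<odot> x"
    and smult_add_right:
      "x \<in> carrier A \<Longrightarrow> y \<in> carrier A \<Longrightarrow> c \<odot> (x \<oplus> y) = c \<odot> x \<oplus> c \<odot> y"
    and smult_smult: "x \<in> carrier A \<Longrightarrow> c \<odot> (d \<odot> x) = (c * d) \<odot> x"
    and smult_one [simp]: "x \<in> carrier A \<Longrightarrow> 1 \<odot> x = x"
    and mult_closed [simp, intro]:
      "x \<in> carrier A \<Longrightarrow> y \<in> carrier A \<Longrightarrow> x \<otimes> y \<in> carrier A"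
    and mult_add_left: "x \<in> carrier A \<Longrightarrow> y \<in> carrier A \<Longrightarrow> z \<in> carrier A \<Longrightarrow>
      (x \<oplus> y) \<otimes> z = x \<otimes> z \<oplus> y \<otimes> z"
    and mult_add_right: "x \<in> carrier A \<Longrightarrow> y \<in> carrier A \<Longrightarrow> z \<in> carrier A \<Longrightarrow>
      x \<otimes> (y \<oplus> z) = x \<otimes> y \<oplus> x \<otimes> z"
    and smult_mult: "x \<in> carrier A \<Longrightarrow> y \<in> carrier A \<Longrightarrow> (c \<odot> x) \<otimes> y = c \<odot> (x \<otimes> y)"
    and mult_smult: "x \<in> carrier A \<Longrightarrow> y \<in> carrier A \<Longrightarrow> x \<otimes> (c \<odot> y) = c \<odot> (x \<otimes> y)"

section \<open>Additive, balanced and bilinear maps\<close>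

lemma (in abelian_group) additive_map_facts:
  assumes G: "abelian_group G'"
    and clo: "\<And>x. x \<in> carrier G \<Longrightarrow> h x \<in> carrier G'"
    and add: "\<And>x y. x \<in> carrier G \<Longrightarrow> y \<in> carrier G \<Longrightarrow> h (x \<oplus> y) = h x \<oplus>\<^bsub>G'\<^esub> h y"
  shows additive_map_zero: "h \<zero> = \<zero>\<^bsub>G'\<^esub>"
    and additive_map_uminus: "x \<in> carrier G \<Longrightarrow> h (\<ominus> x) = \<ominus>\<^bsub>G'\<^esub> h x"
    and additive_map_finsum:
      "f \<in> I \<rightarrow> carrier G \<Longrightarrow> h (\<Oplus>i\<in>I. f i) = (\<Oplus>\<^bsub>G'\<^esub>i\<in>I. h (f i))"
proof -
  interpret G': abelian_group G' by (rule G)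
  have "h \<zero> \<oplus>\<^bsub>G'\<^esub> h \<zero> = h \<zero>" using add[of \<zero> \<zero>] by simp
  then show zero: "h \<zero> = \<zero>\<^bsub>G'\<^esub>" 
    using clo[of \<zero>] by (metis G'.add.r_cancel_one' zero_closed)
  show "h (\<ominus> x) = \<ominus>\<^bsub>G'\<^esub> h x" if x: "x \<in> carrier G"
  proof -
    have "h (\<ominus> x) \<oplus>\<^bsub>G'\<^esub> h x = \<zero>\<^bsub>G'\<^esub>"
      using add[of "\<ominus> x" x] x by (simp add: l_neg zero)
    then show ?thesis
      using clo[of x] clo[of "\<ominus> x"] x G'.minus_equality by simp
  qed
  show "h (\<Oplus>i\<in>I. f i) = (\<Oplus>\<^bsub>G'\<^esub>i\<in>I. h (f i))" if "f \<in> I \<rightarrow> carrier G"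
    using that
  proof (induction I rule: infinite_finite_induct)
    case (insert i I)
    then have "f i \<in> carrier G" "f \<in> I \<rightarrow> carrier G" by auto
    with insert show ?case
      by (simp add: add finsum_closed clo G'.finsum_insert finsum_insert Pi_iff)
  qed (simp_all add: zero)
qed

text \<open>The last three clauses match the three families in \<open>tensor_relators\<close>, so
  these are the maps that descend to additive maps on the tensor product. The notion is kept apart
  from \<open>bilinear_map\<close> because the operations of the tensor product are built from such
  maps before the tensor product is known to be a module.\<close>

definition balanced_map ::
  "('k, 'a) module \<Rightarrow> ('k, 'b) module \<Rightarrow> ('k, 't) module \<Rightarrow> ('a \<Rightarrow> 'b \<Rightarrow> 't) \<Rightarrow> bool" where
  "balanced_map A B G \<phi> \<longleftrightarrow>
     (\<forall>a \<in> carrier A. \<forall>b \<in> carrier B. \<phi> a b \<in> carrier G) \<and>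
     (\<forall>a \<in> carrier A. \<forall>a' \<in> carrier A. \<forall>b \<in> carrier B.
        \<phi> (a \<oplus>\<^bsub>A\<^esub> a') b = \<phi> a b \<oplus>\<^bsub>G\<^esub> \<phi> a' b) \<and>
     (\<forall>a \<in> carrier A. \<forall>b \<in> carrier B. \<forall>b' \<in> carrier B.
        \<phi> a (b \<oplus>\<^bsub>B\<^esub> b') = \<phi> a b \<oplus>\<^bsub>G\<^esub> \<phi> a b') \<and>
     (\<forall>c. \<forall>a \<in> carrier A. \<forall>b \<in> carrier B. \<phi> (c \<odot>\<^bsub>A\<^esub> a) b = \<phi> a (c \<odot>\<^bsub>B\<^esub> b))"

definition bilinear_map ::
  "('k, 'a) module \<Rightarrow> ('k, 'b) module \<Rightarrow> ('k, 't) module \<Rightarrow> ('a \<Rightarrow> 'b \<Rightarrow> 't) \<Rightarrow> bool" where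
  "bilinear_map A B G \<phi> \<longleftrightarrow> balanced_map A B G \<phi> \<and>
     (\<forall>c. \<forall>a \<in> carrier A. \<forall>b \<in> carrier B. \<phi> (c \<odot>\<^bsub>A\<^esub> a) b = c \<odot>\<^bsub>G\<^esub> \<phi> a b)"

lemma balanced_mapD:
  assumes "balanced_map A B G \<phi>"
  shows "a \<in> carrier A \<Longrightarrow> b \<in> carrier B \<Longrightarrow> \<phi> a b \<in> carrier G"
    and "a \<in> carrier A \<Longrightarrow> a' \<in> carrier A \<Longrightarrow> b \<in> carrier B \<Longrightarrow>
      \<phi> (a \<oplus>\<^bsub>A\<^esub> a') b = \<phi> a b \<oplus>\<^bsub>G\<^esub> \<phi> a' b"
    and "a \<in> carrier A \<Longrightarrow> b \<in> carrier B \<Longrightarrow> b' \<in> carrier B \<Longrightarrow>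
      \<phi> a (b \<oplus>\<^bsub>B\<^esub> b') = \<phi> a b \<oplus>\<^bsub>G\<^esub> \<phi> a b'"
    and "a \<in> carrier A \<Longrightarrow> b \<in> carrier B \<Longrightarrow> \<phi> (c \<odot>\<^bsub>A\<^esub> a) b = \<phi> a (c \<odot>\<^bsub>B\<^esub> b)"
  using assms unfolding balanced_map_def by blast+

section \<open>The tensor product as an abelian group: induction, universal property,
  evaluation\<close>

locale tensor_pair = A: bilinear_algebra A + B: bilinear_algebra B
  for A :: "('k::{comm_ring, comm_monoid_mult}, 'a) module"
    and B :: "('k, 'b) module"
begin

abbreviation "F \<equiv> tensor_free A B"
abbreviation "K \<equiv> tensor_kernel A B"
abbreviation "T \<equiv> tensor_algebra A B"

sublocale F: comm_group F
  by (rule abelian_free_Abelian_group)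

lemma relators_subset: "tensor_relators A B \<subseteq> carrier F"
proof -
  have *: "frag_of p - frag_of q - frag_of s \<in> carrier F" "frag_of p - frag_of q \<in> carrier F"
    if "p \<in> carrier A \<times> carrier B" "q \<in> carrier A \<times> carrier B" "s \<in> carrier A \<times> carrier B"
    for p q s :: "'a \<times> 'b"
  proof -
    show "frag_of p - frag_of q \<in> carrier F"
      using keys_diff[of "frag_of p" "frag_of q"] that by auto
    then show "frag_of p - frag_of q - frag_of s \<in> carrier F"
      using keys_diff[of "frag_of p - frag_of q" "frag_of s"] that by auto
  qed
  show ?thesis
    unfolding tensor_relators_def by (auto simp del: carrier_free_Abelian_group_iff intro!: *)
qed

lemma subgroup_kernel: "subgroup K F"
  unfolding tensor_kernel_def by (rule F.generate_is_subgroup[OF relators_subset])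

sublocale K: normal K F
  using subgroup_kernel F.normal_iff_subgroup by blast

lemma carrier_tensor: "carrier T = tensor_coset A B ` carrier F"
  by (simp add: tensor_algebra_def carrier_FactGroup tensor_coset_def)

lemma coset_closed: "x \<in> carrier F \<Longrightarrow> tensor_coset A B x \<in> carrier T"
  by (auto simp: carrier_tensor)

lemma coset_add:
  assumes "x \<in> carrier F" "y \<in> carrier F"
  shows "tensor_coset A B x \<oplus>\<^bsub>T\<^esub> tensor_coset A B y = tensor_coset A B (x + y)"
  using K.rcos_sum[OF assms] by (simp add: tensor_algebra_def tensor_coset_def)

sublocale T: abelian_group T
proof -
  interpret Q: comm_group "F Mod K"
    by (rule F.abelian_FactGroup[OF subgroup_kernel])
  show "abelian_group T"
  proof (rule abelian_groupI)
    fix x assume "x \<in> carrier T"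
    then show "\<exists>y \<in> carrier T. y \<oplus>\<^bsub>T\<^esub> x = \<zero>\<^bsub>T\<^esub>"
      by (auto simp: tensor_algebra_def simp del: mult_FactGroup one_FactGroup intro: Q.l_inv_ex)
  qed (simp_all add: tensor_algebra_def Q.m_ac del: mult_FactGroup one_FactGroup)
qed

lemma pure_closed [simp, intro]:
  "a \<in> carrier A \<Longrightarrow> b \<in> carrier B \<Longrightarrow> pure_tensor A B a b \<in> carrier T"
  by (simp add: pure_tensor_def coset_closed)

lemma coset_relator:
  assumes "x - y \<in> tensor_relators A B" "x \<in> carrier F" "y \<in> carrier F"
  shows "tensor_coset A B x = tensor_coset A B y"
proof -
  have "x \<otimes>\<^bsub>F\<^esub> inv\<^bsub>F\<^esub> y \<in> K"
    using assms generate.incl[of _ "tensor_relators A B" F]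
    by (simp add: tensor_kernel_def)
  then show ?thesis
    unfolding tensor_coset_def
    by (intro F.repr_independence[symmetric] subgroup_kernel assms
        K.rcos_module_rev[OF F.is_group assms(3) assms(2)])
qed

lemma pure_add_left:
  assumes "a \<in> carrier A" "a' \<in> carrier A" "b \<in> carrier B"
  shows "pure_tensor A B (a \<oplus>\<^bsub>A\<^esub> a') b = pure_tensor A B a b \<oplus>\<^bsub>T\<^esub> pure_tensor A B a' b"
proof -
  have "frag_of (a \<oplus>\<^bsub>A\<^esub> a', b) - (frag_of (a, b) + frag_of (a', b)) \<in> tensor_relators A B"
    using assms unfolding tensor_relators_def by (auto simp: diff_diff_add[symmetric])
  then show ?thesis
    using assms F.m_closed[of "frag_of (a, b)" "frag_of (a', b)"]
    by (simp add: pure_tensor_def coset_add) (rule coset_relator, auto)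
qed

lemma pure_add_right:
  assumes "a \<in> carrier A" "b \<in> carrier B" "b' \<in> carrier B"
  shows "pure_tensor A B a (b \<oplus>\<^bsub>B\<^esub> b') = pure_tensor A B a b \<oplus>\<^bsub>T\<^esub> pure_tensor A B a b'"
proof -
  have "frag_of (a, b \<oplus>\<^bsub>B\<^esub> b') - (frag_of (a, b) + frag_of (a, b')) \<in> tensor_relators A B"
    using assms unfolding tensor_relators_def by (auto simp: diff_diff_add[symmetric])
  then show ?thesis
    using assms F.m_closed[of "frag_of (a, b)" "frag_of (a, b')"]
    by (simp add: pure_tensor_def coset_add) (rule coset_relator, auto)
qed

lemma pure_balanced:
  assumes "a \<in> carrier A" "b \<in> carrier B"
  shows "pure_tensor A B (c \<odot>\<^bsub>A\<^esub> a) b = pure_tensor A B a (c \<odot>\<^bsub>B\<^esub> b)"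
  unfolding pure_tensor_def using assms
  by (intro coset_relator) (simp_all add: tensor_relators_def, blast)

lemma coset_zero: "tensor_coset A B 0 = \<zero>\<^bsub>T\<^esub>"
  using coset_add[of 0 0] coset_closed[of 0]
    T.add.r_cancel_one'[of "tensor_coset A B 0" "tensor_coset A B 0"] by simp

lemma coset_uminus: "x \<in> carrier F \<Longrightarrow> tensor_coset A B (- x) = \<ominus>\<^bsub>T\<^esub> tensor_coset A B x"
  using coset_add[of "- x" x] coset_closed[of "- x"] coset_closed[of x] coset_zero
  by (intro T.minus_equality[symmetric]) auto

lemma coset_diff:
  "x \<in> carrier F \<Longrightarrow> y \<in> carrier F \<Longrightarrow>
    tensor_coset A B (x - y) = tensor_coset A B x \<ominus>\<^bsub>T\<^esub> tensor_coset A B y"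
  using coset_add[of x "- y"] by (simp add: coset_uminus a_minus_def)

text \<open>
  No cases for zero and for negatives are needed, as \<open>0 = 0 \<otimes> 0\<close> and \<open>- (a \<otimes> b) = (- a) \<otimes> b\<close>.
\<close>

lemma tensor_induct [consumes 1, case_names pure add]:
  assumes r: "r \<in> carrier T"
    and pure: "\<And>a b. a \<in> carrier A \<Longrightarrow> b \<in> carrier B \<Longrightarrow> P (pure_tensor A B a b)"
    and add: "\<And>x y. x \<in> carrier T \<Longrightarrow> y \<in> carrier T \<Longrightarrow> P x \<Longrightarrow> P y \<Longrightarrow> P (x \<oplus>\<^bsub>T\<^esub> y)"
  shows "P r"
proof -
  let ?c = "tensor_coset A B"
  have p0: "P \<zero>\<^bsub>T\<^esub>"
    using A.additive_map_zero[OF T.abelian_group_axioms, of "\<lambda>a. pure_tensor A B a \<zero>\<^bsub>B\<^esub>"]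
      pure[of "\<zero>\<^bsub>A\<^esub>" "\<zero>\<^bsub>B\<^esub>"] by (simp add: pure_add_left)
  \<comment> \<open>Induction over the free group closes under differences, whereas \<open>P\<close>
    is only known to pass to sums. Carrying the claim for \<open>- x\<close> along turns a
    difference into the sum of \<open>x\<close> and \<open>- y\<close>.\<close>
  have "P (?c x) \<and> P (?c (- x))" if "Poly_Mapping.keys x \<subseteq> carrier A \<times> carrier B" for x
    using that
  proof (induction x rule: free_Abelian_group_induct[consumes 1, case_names zero diff of])
    case zero
    then show ?case using p0 coset_zero by simp
  next
    case (diff x y)
    have "?c (x - y) = ?c x \<oplus>\<^bsub>T\<^esub> ?c (- y)" "?c (- (x - y)) = ?c (- x) \<oplus>\<^bsub>T\<^esub> ?c y"
      using coset_add[of x "- y"] coset_add[of "- x" y] diff by auto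
    then show ?case
      using diff by (auto intro!: add coset_closed)
  next
    case (of p)
    then obtain a b where p: "p = (a, b)" "a \<in> carrier A" "b \<in> carrier B" by auto
    have "?c (- frag_of p) = pure_tensor A B (\<ominus>\<^bsub>A\<^esub> a) b"
      using A.additive_map_uminus[OF T.abelian_group_axioms, of "\<lambda>a. pure_tensor A B a b" a] p
      by (simp add: coset_uminus pure_tensor_def[symmetric] pure_add_left)
    then show ?case
      using p pure[of a b] pure[of "\<ominus>\<^bsub>A\<^esub> a" b] by (simp add: pure_tensor_def)
  qed
  then show ?thesis
    using r by (auto simp: carrier_tensor)
qed

text \<open>The extension \<open>g\<close> of \<open>\<phi>\<close> to the free abelian group kills
  all relators because \<open>\<phi>\<close> is biadditive and balanced. Hence it kills the subgroup
  they generate and factors through the quotient.\<close>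

lemma tensor_universal:
  assumes G: "abelian_group G" and bal: "balanced_map A B G \<phi>"
  obtains h where "\<And>x. x \<in> carrier T \<Longrightarrow> h x \<in> carrier G"
    "\<And>x y. x \<in> carrier T \<Longrightarrow> y \<in> carrier T \<Longrightarrow> h (x \<oplus>\<^bsub>T\<^esub> y) = h x \<oplus>\<^bsub>G\<^esub> h y"
    "\<And>a b. a \<in> carrier A \<Longrightarrow> b \<in> carrier B \<Longrightarrow> h (pure_tensor A B a b) = \<phi> a b"
proof -
  interpret G: abelian_group G by (rule G)
  note phi = balanced_mapD[OF bal]
  have "case_prod \<phi> ` (carrier A \<times> carrier B) \<subseteq> carrier G"
    using phi(1) by auto
  with G.add.free_Abelian_group_universal obtain g
    where g_hom: "g \<in> hom F (add_monoid G)"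
      and g_of: "\<And>p. p \<in> carrier A \<times> carrier B \<Longrightarrow> g (frag_of p) = case_prod \<phi> p"
    by (metis partial_object.select_convs(1))
  interpret g: group_hom F "add_monoid G" g
    by (intro group_hom.intro group_hom_axioms.intro g_hom G.a_group F.is_group)
  have g_diff: "g (x - y) = g x \<ominus>\<^bsub>G\<^esub> g y"
    if "Poly_Mapping.keys x \<subseteq> carrier A \<times> carrier B" "Poly_Mapping.keys y \<subseteq> carrier A \<times> carrier B" for x y
    using g.hom_mult[of x "- y"] g.hom_inv[of y] that
    by (simp add: a_minus_def a_inv_def)
  have keys: "Poly_Mapping.keys (frag_of p - frag_of q) \<subseteq> carrier A \<times> carrier B"
    if "p \<in> carrier A \<times> carrier B" "q \<in> carrier A \<times> carrier B" for p q :: "'a \<times> 'b"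
    using keys_diff[of "frag_of p" "frag_of q"] that by auto
  have "tensor_relators A B \<subseteq> kernel F (add_monoid G) g"
  proof
    fix x assume x: "x \<in> tensor_relators A B"
    have cancel: "(u \<oplus>\<^bsub>G\<^esub> v) \<ominus>\<^bsub>G\<^esub> u \<ominus>\<^bsub>G\<^esub> v = \<zero>\<^bsub>G\<^esub>"
      if "u \<in> carrier G" "v \<in> carrier G" for u v
      using that by (simp add: a_minus_def G.a_comm[of u v] G.a_assoc G.r_neg)
    have cancel': "u \<ominus>\<^bsub>G\<^esub> u = \<zero>\<^bsub>G\<^esub>" if "u \<in> carrier G" for u
      using that by (simp add: a_minus_def G.r_neg)
    have "g x = \<zero>\<^bsub>G\<^esub>"
      using x unfolding tensor_relators_def
      by (elim UnE CollectE exE conjE) (simp_all add: g_diff g_of keys phi cancel cancel')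
    then show "x \<in> kernel F (add_monoid G) g"
      using x relators_subset by (auto simp: kernel_def simp del: carrier_free_Abelian_group_iff)
  qed
  then have "K \<subseteq> kernel F (add_monoid G) g"
    unfolding tensor_kernel_def by (rule F.generate_subgroup_incl[OF _ g.subgroup_kernel])
  with g.FactGroup_universal_kernel[OF K.normal_axioms] obtain h
    where h: "h \<in> hom (F Mod K) (add_monoid G)" "\<And>x. x \<in> carrier F \<Longrightarrow> h (K #>\<^bsub>F\<^esub> x) = g x"
    by blast
  show thesis
  proof (rule that)
    show "h x \<in> carrier G" if "x \<in> carrier T" for x
      using h(1) that unfolding hom_def tensor_algebra_def by auto
    show "h (x \<oplus>\<^bsub>T\<^esub> y) = h x \<oplus>\<^bsub>G\<^esub> h y" if "x \<in> carrier T" "y \<in> carrier T" for x y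
      using h(1) that unfolding hom_def tensor_algebra_def by auto
    show "h (pure_tensor A B a b) = \<phi> a b" if "a \<in> carrier A" "b \<in> carrier B" for a b
      using h(2)[of "frag_of (a, b)"] g_of that by (simp add: pure_tensor_def tensor_coset_def)
  qed
qed

text \<open>Supplies the presentation that \<open>tensor_eval\<close> quantifies over. A pure tensor
  is a sum of length one; for a sum of two tensors the presentations are concatenated, the second
  being shifted by the length \<open>m\<close> of the first.\<close>

lemma tensor_presentation:
  assumes "r \<in> carrier T"
  shows "\<exists>(m::nat) u v. u \<in> {..<m} \<rightarrow> carrier A \<and> v \<in> {..<m} \<rightarrow> carrier B \<and>
    r = (\<Oplus>\<^bsub>T\<^esub>i\<in>{..<m}. pure_tensor A B (u i) (v i))"
  using assms
proof (induction r rule: tensor_induct)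
  case (pure a b)
  then have "pure_tensor A B a b = (\<Oplus>\<^bsub>T\<^esub>i\<in>{..<1::nat}. pure_tensor A B a b)"
    by (simp add: lessThan_Suc T.finsum_insert)
  with pure show ?case
    by (intro exI[of _ 1] exI[of _ "\<lambda>_. a"] exI[of _ "\<lambda>_. b"]) auto
next
  case (add x y)
  obtain m :: nat and u v where x: "u \<in> {..<m} \<rightarrow> carrier A" "v \<in> {..<m} \<rightarrow> carrier B"
    "x = (\<Oplus>\<^bsub>T\<^esub>i\<in>{..<m}. pure_tensor A B (u i) (v i))"
    using add.IH(1) by blast
  obtain k :: nat and u' v' where y: "u' \<in> {..<k} \<rightarrow> carrier A" "v' \<in> {..<k} \<rightarrow> carrier B"
    "y = (\<Oplus>\<^bsub>T\<^esub>i\<in>{..<k}. pure_tensor A B (u' i) (v' i))"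
    using add.IH(2) by blast
  define U V where "U i = (if i < m then u i else u' (i - m))"
    and "V i = (if i < m then v i else v' (i - m))" for i
  let ?f = "\<lambda>i. pure_tensor A B (U i) (V i)"
  have split: "{..<m + k} = {..<m} \<union> (\<lambda>i. i + m) ` {..<k}"
  proof (intro equalityI subsetI)
    fix x assume "x \<in> {..<m + k}"
    then show "x \<in> {..<m} \<union> (\<lambda>i. i + m) ` {..<k}"
      by (cases "x < m") (auto intro!: image_eqI[of _ _ "x - m"])
  qed auto
  have U: "U \<in> {..<m + k} \<rightarrow> carrier A" and V: "V \<in> {..<m + k} \<rightarrow> carrier B"
    using x y by (auto simp: U_def V_def Pi_iff)
  have "(\<Oplus>\<^bsub>T\<^esub>i\<in>{..<m + k}. ?f i)
      = (\<Oplus>\<^bsub>T\<^esub>i\<in>{..<m}. ?f i) \<oplus>\<^bsub>T\<^esub> (\<Oplus>\<^bsub>T\<^esub>i\<in>(\<lambda>i. i + m) ` {..<k}. ?f i)"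
    unfolding split using U V by (intro T.finsum_Un_disjoint) (auto simp: Pi_iff)
  also have "(\<Oplus>\<^bsub>T\<^esub>i\<in>(\<lambda>i. i + m) ` {..<k}. ?f i) = (\<Oplus>\<^bsub>T\<^esub>i\<in>{..<k}. ?f (i + m))"
    using U V by (intro T.finsum_reindex) (auto simp: Pi_iff)
  also have "\<dots> = y"
    unfolding y(3) using y by (intro T.finsum_cong') (auto simp: U_def V_def Pi_iff)
  also have "(\<Oplus>\<^bsub>T\<^esub>i\<in>{..<m}. ?f i) = x"
    unfolding x(3) using x by (intro T.finsum_cong') (auto simp: U_def V_def Pi_iff)
  finally show ?case
    using U V by (intro exI[of _ "m + k"] exI[of _ U] exI[of _ V]) simp
qed

text \<open>An additive \<open>h\<close> with the right values on pure tensors sends every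
  presentation of \<open>r\<close> to the sum attached to it. So all presentations of
  \<open>r\<close> give the same sum, and the definite description denotes
  \<open>h r\<close>.\<close>

lemma tensor_eval_eqI:
  assumes G: "abelian_group G"
    and clo: "\<And>x. x \<in> carrier T \<Longrightarrow> h x \<in> carrier G"
    and add: "\<And>x y. x \<in> carrier T \<Longrightarrow> y \<in> carrier T \<Longrightarrow> h (x \<oplus>\<^bsub>T\<^esub> y) = h x \<oplus>\<^bsub>G\<^esub> h y"
    and pure: "\<And>a b. a \<in> carrier A \<Longrightarrow> b \<in> carrier B \<Longrightarrow> h (pure_tensor A B a b) = \<phi> a b"
    and r: "r \<in> carrier T"
  shows "tensor_eval A B G \<phi> r = h r"
proof -
  interpret G: abelian_group G by (rule G)
  have sum: "(\<Oplus>\<^bsub>G\<^esub>i\<in>{..<m}. \<phi> (u i) (v i)) = h (\<Oplus>\<^bsub>T\<^esub>i\<in>{..<m}. pure_tensor A B (u i) (v i))"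
    if "u \<in> {..<m} \<rightarrow> carrier A" "v \<in> {..<m} \<rightarrow> carrier B" for m :: nat and u v
  proof -
    have "h (\<Oplus>\<^bsub>T\<^esub>i\<in>{..<m}. pure_tensor A B (u i) (v i))
        = (\<Oplus>\<^bsub>G\<^esub>i\<in>{..<m}. h (pure_tensor A B (u i) (v i)))"
      using that by (intro T.additive_map_finsum[OF G clo add]) auto
    also have "\<dots> = (\<Oplus>\<^bsub>G\<^esub>i\<in>{..<m}. \<phi> (u i) (v i))"
      using that clo by (intro G.finsum_cong') (auto simp: Pi_iff simp flip: pure)
    finally show ?thesis ..
  qed
  show ?thesis
    unfolding tensor_eval_def
  proof (rule the_equality)
    obtain m :: nat and u v where "u \<in> {..<m} \<rightarrow> carrier A" "v \<in> {..<m} \<rightarrow> carrier B"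
      "r = (\<Oplus>\<^bsub>T\<^esub>i\<in>{..<m}. pure_tensor A B (u i) (v i))"
      using tensor_presentation[OF r] by blast
    with sum[of u m v] show "\<exists>(m::nat) u v. u \<in> {..<m} \<rightarrow> carrier A \<and> v \<in> {..<m} \<rightarrow> carrier B \<and>
      r = (\<Oplus>\<^bsub>T\<^esub>i\<in>{..<m}. pure_tensor A B (u i) (v i)) \<and>
      h r = (\<Oplus>\<^bsub>G\<^esub>i\<in>{..<m}. \<phi> (u i) (v i))"
      by (intro exI[of _ m] exI[of _ u] exI[of _ v]) simp
  qed (auto simp: sum)
qed

text \<open>The map from \<open>tensor_universal\<close> serves as \<open>h\<close> in
  \<open>tensor_eval_eqI\<close>. From here on \<open>tensor_eval\<close> is handled through these
  three facts and \<open>tensor_induct\<close>, without presentations.\<close>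

lemma tensor_eval_facts:
  assumes G: "abelian_group G" and bal: "balanced_map A B G \<phi>"
  shows tensor_eval_pure [simp]: "\<And>a b. a \<in> carrier A \<Longrightarrow> b \<in> carrier B \<Longrightarrow>
      tensor_eval A B G \<phi> (pure_tensor A B a b) = \<phi> a b"
    and tensor_eval_closed [simp]: "\<And>x. x \<in> carrier T \<Longrightarrow> tensor_eval A B G \<phi> x \<in> carrier G"
    and tensor_eval_add: "\<And>x y. x \<in> carrier T \<Longrightarrow> y \<in> carrier T \<Longrightarrow>
      tensor_eval A B G \<phi> (x \<oplus>\<^bsub>T\<^esub> y) = tensor_eval A B G \<phi> x \<oplus>\<^bsub>G\<^esub> tensor_eval A B G \<phi> y"
proof -
  obtain h where h: "\<And>x. x \<in> carrier T \<Longrightarrow> h x \<in> carrier G"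
    "\<And>x y. x \<in> carrier T \<Longrightarrow> y \<in> carrier T \<Longrightarrow> h (x \<oplus>\<^bsub>T\<^esub> y) = h x \<oplus>\<^bsub>G\<^esub> h y"
    "\<And>a b. a \<in> carrier A \<Longrightarrow> b \<in> carrier B \<Longrightarrow> h (pure_tensor A B a b) = \<phi> a b"
    using tensor_universal[OF assms] by metis
  note eq = tensor_eval_eqI[OF G h]
  show "tensor_eval A B G \<phi> (pure_tensor A B a b) = \<phi> a b" if "a \<in> carrier A" "b \<in> carrier B" for a b
    using that by (simp add: eq h)
  show "tensor_eval A B G \<phi> x \<in> carrier G" if "x \<in> carrier T" for x
    using that by (simp add: eq h)
  show "tensor_eval A B G \<phi> (x \<oplus>\<^bsub>T\<^esub> y) = tensor_eval A B G \<phi> x \<oplus>\<^bsub>G\<^esub> tensor_eval A B G \<phi> y"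
    if "x \<in> carrier T" "y \<in> carrier T" for x y
    using that by (simp add: eq h)
qed

section \<open>Scalar multiplication and product of cosets\<close>

lemma coset_member:
  assumes "U \<in> carrier T" "x \<in> U"
  shows "x \<in> carrier F" "tensor_coset A B x = U"
proof -
  obtain z where z: "z \<in> carrier F" "U = K #>\<^bsub>F\<^esub> z"
    using assms(1) by (auto simp: carrier_tensor tensor_coset_def)
  show "x \<in> carrier F"
    using F.r_coset_subset_G[OF K.subset z(1)] assms(2) z(2) by blast
  show "tensor_coset A B x = U"
    using F.repr_independence[OF _ z(1) subgroup_kernel] assms(2) z(2)
    by (simp add: tensor_coset_def)
qed

lemma coset_nonempty: "U \<in> carrier T \<Longrightarrow> U \<noteq> {}"
  using F.rcos_self[OF _ subgroup_kernel] unfolding carrier_tensor tensor_coset_def by blast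

text \<open>Compares an operation \<open>e\<close> on representatives with an operation
  \<open>h\<close> on cosets. Both are additive, so agreement on generators is enough. It follows
  that the coset of \<open>e x\<close> depends on the coset of \<open>x\<close> alone, with no
  separate check that \<open>e\<close> preserves the kernel.\<close>

lemma coset_lift_eq:
  assumes e_diff: "\<And>x y. e (x - y) = e x - e y"
    and e_of: "\<And>a b. a \<in> carrier A \<Longrightarrow> b \<in> carrier B \<Longrightarrow> e (frag_of (a, b)) \<in> carrier F"
    and h_closed: "\<And>x. x \<in> carrier T \<Longrightarrow> h x \<in> carrier T"
    and h_add: "\<And>x y. x \<in> carrier T \<Longrightarrow> y \<in> carrier T \<Longrightarrow> h (x \<oplus>\<^bsub>T\<^esub> y) = h x \<oplus>\<^bsub>T\<^esub> h y"
    and h_pure: "\<And>a b. a \<in> carrier A \<Longrightarrow> b \<in> carrier B \<Longrightarrow>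
      tensor_coset A B (e (frag_of (a, b))) = h (pure_tensor A B a b)"
    and x: "x \<in> carrier F"
  shows "e x \<in> carrier F" "tensor_coset A B (e x) = h (tensor_coset A B x)"
proof -
  have e0: "e 0 = 0" using e_diff[of 0 0] by simp
  note h_zero = T.additive_map_zero[OF T.abelian_group_axioms h_closed h_add]
  note h_uminus = T.additive_map_uminus[OF T.abelian_group_axioms h_closed h_add]
  have "Poly_Mapping.keys x \<subseteq> carrier A \<times> carrier B" using x by simp
  then have "e x \<in> carrier F \<and> tensor_coset A B (e x) = h (tensor_coset A B x)"
  proof (induction x rule: free_Abelian_group_induct[consumes 1, case_names zero diff of])
    case zero
    then show ?case by (simp add: e0 coset_zero h_zero)
  next
    case (diff x y)
    have "e x - e y \<in> carrier F"
      using diff keys_diff[of "e x" "e y"] by auto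
    then show ?case
      using diff coset_closed[of x] coset_closed[of y]
      by (simp add: e_diff coset_diff a_minus_def h_add h_uminus)
  next
    case (of p)
    then show ?case using e_of h_pure by (cases p) (simp add: pure_tensor_def)
  qed
  then show "e x \<in> carrier F" "tensor_coset A B (e x) = h (tensor_coset A B x)" by auto
qed

lemma balanced_smult: "balanced_map A B T (\<lambda>a b. pure_tensor A B (c \<odot>\<^bsub>A\<^esub> a) b)"
  using A.smult_smult
  by (simp add: balanced_map_def pure_add_left pure_add_right A.smult_add_right
      mult.commute flip: pure_balanced)

text \<open>The scalar multiple is defined as a union over representatives. By
  \<open>coset_lift_eq\<close> all cosets in this union are the same \<open>?h U\<close>, and the
  union is over a nonempty set, so it collapses to that coset.\<close>

lemma tensor_smult_eq:
  assumes U: "U \<in> carrier T"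
  shows "c \<odot>\<^bsub>T\<^esub> U = tensor_eval A B T (\<lambda>a b. pure_tensor A B (c \<odot>\<^bsub>A\<^esub> a) b) U" (is "_ = ?h U")
proof -
  note h = tensor_eval_facts[OF T.abelian_group_axioms balanced_smult]
  have "tensor_coset A B (tensor_free_smult A c x) = ?h U" if "x \<in> U" for x
  proof -
    have "tensor_coset A B (tensor_free_smult A c x) = ?h (tensor_coset A B x)"
    proof (rule coset_lift_eq)
      show "tensor_free_smult A c (x - y) = tensor_free_smult A c x - tensor_free_smult A c y"
        for x y :: "'a \<times> 'b \<Rightarrow>\<^sub>0 int"
        by (simp add: tensor_free_smult_def frag_extend_diff)
    qed (use h coset_member[OF U that] in
        \<open>simp_all add: tensor_free_smult_def flip: pure_tensor_def\<close>)
    then show ?thesis using coset_member[OF U that] by simp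
  qed
  then show ?thesis
    using coset_nonempty[OF U] by (simp add: tensor_algebra_def)
qed

lemma smult_pure:
  "a \<in> carrier A \<Longrightarrow> b \<in> carrier B \<Longrightarrow>
    c \<odot>\<^bsub>T\<^esub> pure_tensor A B a b = pure_tensor A B (c \<odot>\<^bsub>A\<^esub> a) b"
  by (simp add: tensor_smult_eq tensor_eval_pure[OF T.abelian_group_axioms balanced_smult])

lemma tensor_smult_closed: "U \<in> carrier T \<Longrightarrow> c \<odot>\<^bsub>T\<^esub> U \<in> carrier T"
  by (simp add: tensor_smult_eq tensor_eval_closed[OF T.abelian_group_axioms balanced_smult])

lemma tensor_smult_add:
  "U \<in> carrier T \<Longrightarrow> V \<in> carrier T \<Longrightarrow> c \<odot>\<^bsub>T\<^esub> (U \<oplus>\<^bsub>T\<^esub> V) = c \<odot>\<^bsub>T\<^esub> U \<oplus>\<^bsub>T\<^esub> c \<odot>\<^bsub>T\<^esub> V"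
  by (simp add: tensor_smult_eq tensor_eval_add[OF T.abelian_group_axioms balanced_smult])

text \<open>A candidate for the product of \<open>s\<close> with the pure tensor c \<otimes> d,
  available before the product of \<open>T\<close> is under control. The full product arises by
  letting c \<otimes> d vary and evaluating at the second factor.\<close>

definition right_pure_mult where
  "right_pure_mult s c d =
     tensor_eval A B T (\<lambda>a b. pure_tensor A B (a \<otimes>\<^bsub>A\<^esub> c) (b \<otimes>\<^bsub>B\<^esub> d)) s"

lemma balanced_mult:
  "c \<in> carrier A \<Longrightarrow> d \<in> carrier B \<Longrightarrow>
    balanced_map A B T (\<lambda>a b. pure_tensor A B (a \<otimes>\<^bsub>A\<^esub> c) (b \<otimes>\<^bsub>B\<^esub> d))"
  by (simp add: balanced_map_def pure_add_left pure_add_right A.mult_add_left B.mult_add_left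
      A.smult_mult B.smult_mult pure_balanced)

lemmas right_pure_mult = tensor_eval_facts[OF T.abelian_group_axioms balanced_mult,
    folded right_pure_mult_def]

lemma balanced_right_pure_mult:
  assumes "s \<in> carrier T"
  shows "balanced_map A B T (right_pure_mult s)"
  unfolding balanced_map_def
proof (intro conjI ballI allI)
  fix c c' d assume cd: "c \<in> carrier A" "c' \<in> carrier A" "d \<in> carrier B"
  show "right_pure_mult s (c \<oplus>\<^bsub>A\<^esub> c') d = right_pure_mult s c d \<oplus>\<^bsub>T\<^esub> right_pure_mult s c' d"
    using assms
    by (induction s rule: tensor_induct)
      (simp_all add: cd right_pure_mult A.mult_add_right pure_add_left T.a_ac)
next
  fix c d d' assume cd: "c \<in> carrier A" "d' \<in> carrier B" "d \<in> carrier B"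
  show "right_pure_mult s c (d \<oplus>\<^bsub>B\<^esub> d') = right_pure_mult s c d \<oplus>\<^bsub>T\<^esub> right_pure_mult s c d'"
    using assms
    by (induction s rule: tensor_induct)
      (simp_all add: cd right_pure_mult B.mult_add_right pure_add_right T.a_ac)
next
  fix k c d assume cd: "c \<in> carrier A" "d \<in> carrier B"
  show "right_pure_mult s (k \<odot>\<^bsub>A\<^esub> c) d = right_pure_mult s c (k \<odot>\<^bsub>B\<^esub> d)"
    using assms
    by (induction s rule: tensor_induct)
      (simp_all add: cd right_pure_mult A.mult_smult B.mult_smult pure_balanced)
qed (simp add: assms right_pure_mult)

text \<open>\<open>coset_lift_eq\<close> is applied twice: in the second argument with a free
  generator as the first one (\<open>inner\<close>), then in the first argument with the coset of
  \<open>y\<close> fixed. The second application rests on \<open>M_add\<close>, the additivity of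
  the candidate product in its first argument.\<close>

lemma tensor_mult_eq:
  assumes U: "U \<in> carrier T" and V: "V \<in> carrier T"
  shows "U \<otimes>\<^bsub>T\<^esub> V = tensor_eval A B T (right_pure_mult U) V"
proof -
  let ?M = "\<lambda>U. tensor_eval A B T (right_pure_mult U)"
  have free_mult_diff: "tensor_free_mult A B (x - x') y = tensor_free_mult A B x y - tensor_free_mult A B x' y"
    "tensor_free_mult A B x (y - y') = tensor_free_mult A B x y - tensor_free_mult A B x y'"
    for x x' y y' :: "'a \<times> 'b \<Rightarrow>\<^sub>0 int"
  proof -
    show "tensor_free_mult A B (x - x') y = tensor_free_mult A B x y - tensor_free_mult A B x' y"
      by (simp add: tensor_free_mult_def frag_extend_diff)
    \<comment> \<open>Here the difference stands inside the outer \<open>frag_extend\<close>, so the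
      claim is reduced to generators by induction on \<open>x\<close>.\<close>
    show "tensor_free_mult A B x (y - y') = tensor_free_mult A B x y - tensor_free_mult A B x y'"
      unfolding tensor_free_mult_def
      using subset_UNIV[of "Poly_Mapping.keys x"]
    proof (induction x rule: frag_induction)
      case (one x)
      then show ?case by (cases x) (simp add: frag_extend_diff)
    qed (simp_all add: frag_extend_diff)
  qed
  have M_add: "?M (s \<oplus>\<^bsub>T\<^esub> s') t = ?M s t \<oplus>\<^bsub>T\<^esub> ?M s' t"
    if "s \<in> carrier T" "s' \<in> carrier T" "t \<in> carrier T" for s s' t
    using that(3)
    by (induction t rule: tensor_induct)
      (simp_all add: that right_pure_mult T.a_ac
        tensor_eval_facts[OF T.abelian_group_axioms balanced_right_pure_mult])
  have inner: "tensor_free_mult A B (frag_of (a, b)) y \<in> carrier F \<and>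
      tensor_coset A B (tensor_free_mult A B (frag_of (a, b)) y) = ?M (pure_tensor A B a b) (tensor_coset A B y)"
    if "a \<in> carrier A" "b \<in> carrier B" "y \<in> carrier F" for a b y
  proof -
    note * = tensor_eval_facts[OF T.abelian_group_axioms balanced_right_pure_mult, of "pure_tensor A B a b"]
    have "tensor_free_mult A B (frag_of (a, b)) (frag_of (c, d)) \<in> carrier F"
      "tensor_coset A B (tensor_free_mult A B (frag_of (a, b)) (frag_of (c, d)))
        = ?M (pure_tensor A B a b) (pure_tensor A B c d)"
      if "c \<in> carrier A" "d \<in> carrier B" for c d
      using that \<open>a \<in> carrier A\<close> \<open>b \<in> carrier B\<close>
      by (simp_all add: tensor_free_mult_def * right_pure_mult flip: pure_tensor_def)
    then show ?thesis
      using coset_lift_eq[of "tensor_free_mult A B (frag_of (a, b))" "?M (pure_tensor A B a b)" y] that *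
        free_mult_diff(2)
      by auto
  qed
  have "tensor_coset A B (tensor_free_mult A B x y) = ?M U V" if "x \<in> U" "y \<in> V" for x y
  proof -
    note x = coset_member[OF U that(1)] and y = coset_member[OF V that(2)]
    have "tensor_coset A B (tensor_free_mult A B x y) = ?M (tensor_coset A B x) (tensor_coset A B y)"
    proof (rule coset_lift_eq(2)[of "\<lambda>x. tensor_free_mult A B x y" "\<lambda>s. ?M s (tensor_coset A B y)"])
      show "?M s (tensor_coset A B y) \<in> carrier T" if "s \<in> carrier T" for s
        using that coset_closed[OF y(1)]
        by (rule tensor_eval_facts(2)[OF T.abelian_group_axioms balanced_right_pure_mult])
      show "?M (s \<oplus>\<^bsub>T\<^esub> s') (tensor_coset A B y)
          = ?M s (tensor_coset A B y) \<oplus>\<^bsub>T\<^esub> ?M s' (tensor_coset A B y)"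
        if "s \<in> carrier T" "s' \<in> carrier T" for s s'
        using that coset_closed[OF y(1)] by (rule M_add)
    qed (use inner x y in \<open>blast intro: free_mult_diff(1)\<close>)+
    then show ?thesis using x y by simp
  qed
  then show ?thesis
    using coset_nonempty[OF U] coset_nonempty[OF V] by (simp add: tensor_algebra_def)
qed

lemma mult_pure:
  "a \<in> carrier A \<Longrightarrow> b \<in> carrier B \<Longrightarrow> c \<in> carrier A \<Longrightarrow> d \<in> carrier B \<Longrightarrow>
    pure_tensor A B a b \<otimes>\<^bsub>T\<^esub> pure_tensor A B c d = pure_tensor A B (a \<otimes>\<^bsub>A\<^esub> c) (b \<otimes>\<^bsub>B\<^esub> d)"
  by (simp add: tensor_mult_eq right_pure_mult
      tensor_eval_facts[OF T.abelian_group_axioms balanced_right_pure_mult])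

lemma tensor_mult_closed: "U \<in> carrier T \<Longrightarrow> V \<in> carrier T \<Longrightarrow> U \<otimes>\<^bsub>T\<^esub> V \<in> carrier T"
  by (simp add: tensor_mult_eq
      tensor_eval_facts[OF T.abelian_group_axioms balanced_right_pure_mult])

lemma tensor_mult_add_right:
  "U \<in> carrier T \<Longrightarrow> V \<in> carrier T \<Longrightarrow> W \<in> carrier T \<Longrightarrow>
    U \<otimes>\<^bsub>T\<^esub> (V \<oplus>\<^bsub>T\<^esub> W) = U \<otimes>\<^bsub>T\<^esub> V \<oplus>\<^bsub>T\<^esub> U \<otimes>\<^bsub>T\<^esub> W"
  by (simp add: tensor_mult_eq
      tensor_eval_facts[OF T.abelian_group_axioms balanced_right_pure_mult])

lemma tensor_mult_add_left:
  assumes "U \<in> carrier T" "V \<in> carrier T" "W \<in> carrier T"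
  shows "(U \<oplus>\<^bsub>T\<^esub> V) \<otimes>\<^bsub>T\<^esub> W = U \<otimes>\<^bsub>T\<^esub> W \<oplus>\<^bsub>T\<^esub> V \<otimes>\<^bsub>T\<^esub> W"
  using assms(3)
proof (induction W rule: tensor_induct)
  case (pure a b)
  then show ?case
    by (simp add: assms tensor_mult_eq right_pure_mult
        tensor_eval_facts[OF T.abelian_group_axioms balanced_right_pure_mult])
qed (simp add: assms tensor_mult_add_right tensor_mult_closed T.a_ac)

text \<open>The axioms not yet proved are additive in each tensor variable and are therefore checked
  on pure tensors, by nested inductions when two variables occur. The result allows \<open>T\<close>
  to be a factor of a further tensor product.\<close>

sublocale T: bilinear_algebra T
proof
  fix x y z :: "('a \<times> 'b \<Rightarrow>\<^sub>0 int) set" and c d :: 'k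
  assume x: "x \<in> carrier T"
  show "c \<odot>\<^bsub>T\<^esub> x \<in> carrier T" using x by (rule tensor_smult_closed)
  show "(c + d) \<odot>\<^bsub>T\<^esub> x = c \<odot>\<^bsub>T\<^esub> x \<oplus>\<^bsub>T\<^esub> d \<odot>\<^bsub>T\<^esub> x"
    using x by (induction x rule: tensor_induct)
      (simp_all add: smult_pure A.smult_add_left pure_add_left tensor_smult_add
        tensor_smult_closed T.a_ac)
  show "c \<odot>\<^bsub>T\<^esub> (d \<odot>\<^bsub>T\<^esub> x) = (c * d) \<odot>\<^bsub>T\<^esub> x"
    using x by (induction x rule: tensor_induct)
      (simp_all add: smult_pure A.smult_smult tensor_smult_add tensor_smult_closed)
  show "1 \<odot>\<^bsub>T\<^esub> x = x"
    using x by (induction x rule: tensor_induct) (simp_all add: smult_pure tensor_smult_add)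
  assume y: "y \<in> carrier T"
  show "c \<odot>\<^bsub>T\<^esub> (x \<oplus>\<^bsub>T\<^esub> y) = c \<odot>\<^bsub>T\<^esub> x \<oplus>\<^bsub>T\<^esub> c \<odot>\<^bsub>T\<^esub> y"
    using x y by (rule tensor_smult_add)
  show "x \<otimes>\<^bsub>T\<^esub> y \<in> carrier T" using x y by (rule tensor_mult_closed)
  show "(c \<odot>\<^bsub>T\<^esub> x) \<otimes>\<^bsub>T\<^esub> y = c \<odot>\<^bsub>T\<^esub> (x \<otimes>\<^bsub>T\<^esub> y)"
    using x
  proof (induction x rule: tensor_induct)
    case (pure a b)
    from y show ?case
      by (induction y rule: tensor_induct)
        (simp_all add: pure smult_pure mult_pure A.smult_mult tensor_mult_add_right
          tensor_smult_add tensor_smult_closed tensor_mult_closed)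
  qed (simp add: y tensor_mult_add_left tensor_smult_add tensor_smult_closed tensor_mult_closed)
  show "x \<otimes>\<^bsub>T\<^esub> (c \<odot>\<^bsub>T\<^esub> y) = c \<odot>\<^bsub>T\<^esub> (x \<otimes>\<^bsub>T\<^esub> y)"
    using x
  proof (induction x rule: tensor_induct)
    case (pure a b)
    from y show ?case
      by (induction y rule: tensor_induct)
        (simp_all add: pure smult_pure mult_pure A.mult_smult tensor_mult_add_right
          tensor_smult_add tensor_smult_closed tensor_mult_closed)
  qed (simp add: y tensor_mult_add_left tensor_smult_add tensor_smult_closed tensor_mult_closed)
  assume z: "z \<in> carrier T"
  show "(x \<oplus>\<^bsub>T\<^esub> y) \<otimes>\<^bsub>T\<^esub> z = x \<otimes>\<^bsub>T\<^esub> z \<oplus>\<^bsub>T\<^esub> y \<otimes>\<^bsub>T\<^esub> z"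
    using x y z by (rule tensor_mult_add_left)
  show "x \<otimes>\<^bsub>T\<^esub> (y \<oplus>\<^bsub>T\<^esub> z) = x \<otimes>\<^bsub>T\<^esub> y \<oplus>\<^bsub>T\<^esub> x \<otimes>\<^bsub>T\<^esub> z"
    using x y z by (rule tensor_mult_add_right)
qed

lemma tensor_eval_smult:
  assumes G: "bilinear_algebra G" and bil: "bilinear_map A B G \<phi>" and x: "x \<in> carrier T"
  shows "tensor_eval A B G \<phi> (c \<odot>\<^bsub>T\<^esub> x) = c \<odot>\<^bsub>G\<^esub> tensor_eval A B G \<phi> x"
proof -
  interpret G: bilinear_algebra G by (rule G)
  have bal: "balanced_map A B G \<phi>" using bil by (simp add: bilinear_map_def)
  note eval = tensor_eval_facts[OF G.abelian_group_axioms bal]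
  show ?thesis
    using x bil
    by (induction x rule: tensor_induct)
      (simp_all add: bilinear_map_def smult_pure eval T.smult_add_right G.smult_add_right)
qed

end

subsection \<open>Coordinates\<close>

text \<open>The base ring as an algebra over itself, so that coordinate functionals on a tensor
  product are instances of \<open>tensor_eval\<close>.\<close>

definition scalar_module :: "('k::{comm_ring, comm_monoid_mult}, 'k) module" where
  "scalar_module = \<lparr>carrier = UNIV, mult = (*), one = 1, ring.zero = 0, add = (+), smult = (*)\<rparr>"

lemma scalar_module_simps [simp]:
  "carrier scalar_module = UNIV" "add scalar_module = (+)" "ring.zero scalar_module = 0"
  "mult scalar_module = (*)" "smult scalar_module = (*)"
  by (simp_all add: scalar_module_def)

interpretation scalar: bilinear_algebra scalar_module
proof (intro bilinear_algebra.intro abelian_groupI)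
  fix x :: 'a
  show "\<exists>y \<in> carrier scalar_module. y \<oplus>\<^bsub>scalar_module\<^esub> x = \<zero>\<^bsub>scalar_module\<^esub>"
    by (auto intro: exI[of _ "- x"])
qed (unfold_locales, auto simp: algebra_simps)

lemma finsum_scalar_module: "finsum scalar_module f I = sum f I"
  by (induction I rule: infinite_finite_induct) simp_all

lemma (in abelian_monoid) finsum_Times:
  assumes "finite I" "finite J" "\<And>i j. i \<in> I \<Longrightarrow> j \<in> J \<Longrightarrow> f i j \<in> carrier G"
  shows "(\<Oplus>p\<in>I \<times> J. case_prod f p) = (\<Oplus>i\<in>I. \<Oplus>j\<in>J. f i j)"
  using assms(1,3)
proof (induction I)
  case (insert i I)
  have split: "insert i I \<times> J = Pair i ` J \<union> I \<times> J" by auto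
  have "(\<Oplus>p\<in>insert i I \<times> J. case_prod f p)
      = (\<Oplus>p\<in>Pair i ` J. case_prod f p) \<oplus> (\<Oplus>p\<in>I \<times> J. case_prod f p)"
    unfolding split using insert assms(2)
    by (intro finsum_Un_disjoint) (auto simp: Pi_iff)
  also have "(\<Oplus>p\<in>Pair i ` J. case_prod f p) = (\<Oplus>j\<in>J. f i j)"
    using insert.prems by (subst finsum_reindex) (auto simp: Pi_iff inj_on_def)
  finally show ?case
    using insert by (simp add: Pi_iff finsum_closed)
qed simp

text \<open>A finite dual basis, as for finitely generated projective modules. The functionals
  \<open>c s\<close> reconstruct every element; hence they separate points, and this form of the
  condition passes to tensor products.\<close>

locale coordinate_frame = bilinear_algebra A
  for A :: "('k::{comm_ring, comm_monoid_mult}, 'a) module" (structure) +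
  fixes I :: "'i set" and e :: "'i \<Rightarrow> 'a" and c :: "'i \<Rightarrow> 'a \<Rightarrow> 'k"
  assumes finite_index: "finite I"
    and frame_closed: "s \<in> I \<Longrightarrow> e s \<in> carrier A"
    and coord_add: "s \<in> I \<Longrightarrow> x \<in> carrier A \<Longrightarrow> y \<in> carrier A \<Longrightarrow> c s (x \<oplus> y) = c s x + c s y"
    and coord_smult: "s \<in> I \<Longrightarrow> x \<in> carrier A \<Longrightarrow> c s (k \<odot> x) = k * c s x"
    and expansion: "x \<in> carrier A \<Longrightarrow> (\<Oplus>s\<in>I. c s x \<odot> e s) = x"
begin

lemma coord_eqI:
  assumes "x \<in> carrier A" "y \<in> carrier A" "\<And>s. s \<in> I \<Longrightarrow> c s x = c s y"
  shows "x = y"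
proof -
  have "(\<Oplus>s\<in>I. c s x \<odot> e s) = (\<Oplus>s\<in>I. c s y \<odot> e s)"
    using assms frame_closed by (intro finsum_cong') auto
  then show ?thesis using assms by (simp add: expansion)
qed

end

context tensor_pair
begin

definition tensor_coord where
  "tensor_coord c d = (\<lambda>(s, t). tensor_eval A B scalar_module (\<lambda>a b. c s a * d t b))"

context
  fixes I :: "'i set" and e c and J :: "'j set" and f d
  assumes frame_A: "coordinate_frame A I e c" and frame_B: "coordinate_frame B J f d"
begin

interpretation A: coordinate_frame A I e c by (rule frame_A)
interpretation B: coordinate_frame B J f d by (rule frame_B)

lemma bilinear_coord:
  "s \<in> I \<Longrightarrow> t \<in> J \<Longrightarrow> bilinear_map A B scalar_module (\<lambda>a b. c s a * d t b)"
  by (simp add: bilinear_map_def balanced_map_def A.coord_add B.coord_add A.coord_smult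
      B.coord_smult algebra_simps)

lemma tensor_coord_pure:
  assumes "s \<in> I" "t \<in> J" "a \<in> carrier A" "b \<in> carrier B"
  shows "tensor_coord c d (s, t) (pure_tensor A B a b) = c s a * d t b"
  using assms bilinear_coord[of s t] tensor_eval_pure[OF scalar.abelian_group_axioms]
  by (simp add: tensor_coord_def bilinear_map_def)

lemma tensor_coord_add:
  assumes "s \<in> I" "t \<in> J" "x \<in> carrier T" "y \<in> carrier T"
  shows "tensor_coord c d (s, t) (x \<oplus>\<^bsub>T\<^esub> y) = tensor_coord c d (s, t) x + tensor_coord c d (s, t) y"
  using assms bilinear_coord[of s t] tensor_eval_add[OF scalar.abelian_group_axioms]
  by (simp add: tensor_coord_def bilinear_map_def)

lemma tensor_coord_smult:
  assumes "s \<in> I" "t \<in> J" "x \<in> carrier T"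
  shows "tensor_coord c d (s, t) (k \<odot>\<^bsub>T\<^esub> x) = k * tensor_coord c d (s, t) x"
  using tensor_eval_smult[OF scalar.bilinear_algebra_axioms bilinear_coord] assms
  by (simp add: tensor_coord_def)

text \<open>Both sides of the expansion are additive, so pure tensors suffice. There the scalars are
  distributed over the two factors, and the double sum collapses to a \<otimes> b by expanding first
  \<open>b\<close> and then \<open>a\<close>. Used twice, this gives coordinates on A \<otimes> A
  \<otimes> A.\<close>

lemma tensor_frame:
  "coordinate_frame T (I \<times> J) (\<lambda>(s, t). pure_tensor A B (e s) (f t)) (tensor_coord c d)"
proof
  show "finite (I \<times> J)" using A.finite_index B.finite_index by simp
  show "(case st of (s, t) \<Rightarrow> pure_tensor A B (e s) (f t)) \<in> carrier T" if "st \<in> I \<times> J" for st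
    using that A.frame_closed B.frame_closed by auto
  show "tensor_coord c d st (x \<oplus>\<^bsub>T\<^esub> y) = tensor_coord c d st x + tensor_coord c d st y"
    if "st \<in> I \<times> J" "x \<in> carrier T" "y \<in> carrier T" for st x y
    using that tensor_coord_add by auto
  show "tensor_coord c d st (k \<odot>\<^bsub>T\<^esub> x) = k * tensor_coord c d st x"
    if "st \<in> I \<times> J" "x \<in> carrier T" for st x k
    using that tensor_coord_smult by auto
  let ?g = "\<lambda>x st. tensor_coord c d st x \<odot>\<^bsub>T\<^esub> (case st of (s, t) \<Rightarrow> pure_tensor A B (e s) (f t))"
  have g_closed: "?g x \<in> I \<times> J \<rightarrow> carrier T" for x
    using A.frame_closed B.frame_closed by auto
  show "finsum T (?g x) (I \<times> J) = x" if "x \<in> carrier T" for x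
    using that
  proof (induction x rule: tensor_induct)
    case (pure a b)
    have "finsum T (?g (pure_tensor A B a b)) (I \<times> J)
        = (\<Oplus>\<^bsub>T\<^esub>p\<in>I \<times> J. case p of (s, t) \<Rightarrow> pure_tensor A B (c s a \<odot>\<^bsub>A\<^esub> e s) (d t b \<odot>\<^bsub>B\<^esub> f t))"
      using pure A.frame_closed B.frame_closed
      by (intro T.finsum_cong')
        (auto simp: tensor_coord_pure smult_pure A.smult_smult mult.commute simp flip: pure_balanced)
    also have "\<dots> = (\<Oplus>\<^bsub>T\<^esub>s\<in>I. \<Oplus>\<^bsub>T\<^esub>t\<in>J. pure_tensor A B (c s a \<odot>\<^bsub>A\<^esub> e s) (d t b \<odot>\<^bsub>B\<^esub> f t))"
      using A.finite_index B.finite_index A.frame_closed B.frame_closed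
      by (intro T.finsum_Times) auto
    also have "\<dots> = (\<Oplus>\<^bsub>T\<^esub>s\<in>I. pure_tensor A B (c s a \<odot>\<^bsub>A\<^esub> e s) b)"
    proof (rule T.finsum_cong')
      fix s assume s: "s \<in> I"
      show "(\<Oplus>\<^bsub>T\<^esub>t\<in>J. pure_tensor A B (c s a \<odot>\<^bsub>A\<^esub> e s) (d t b \<odot>\<^bsub>B\<^esub> f t))
          = pure_tensor A B (c s a \<odot>\<^bsub>A\<^esub> e s) b"
        using s A.frame_closed B.frame_closed B.expansion[OF pure(2)]
          B.additive_map_finsum[OF T.abelian_group_axioms,
            of "pure_tensor A B (c s a \<odot>\<^bsub>A\<^esub> e s)" "\<lambda>t. d t b \<odot>\<^bsub>B\<^esub> f t" J]
        by (simp add: pure_add_right)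
    qed (use pure A.frame_closed in auto)
    also have "\<dots> = pure_tensor A B a b"
      using A.frame_closed pure A.expansion[OF pure(1)]
        A.additive_map_finsum[OF T.abelian_group_axioms,
          of "\<lambda>x. pure_tensor A B x b" "\<lambda>s. c s a \<odot>\<^bsub>A\<^esub> e s" I]
      by (simp add: pure_add_left)
    finally show ?case .
  next
    case (add x y)
    have "finsum T (?g (x \<oplus>\<^bsub>T\<^esub> y)) (I \<times> J)
        = (\<Oplus>\<^bsub>T\<^esub>st\<in>I \<times> J. ?g x st \<oplus>\<^bsub>T\<^esub> ?g y st)"
      using add.hyps g_closed A.frame_closed B.frame_closed
      by (intro T.finsum_cong') (auto simp: tensor_coord_add T.smult_add_left)
    also have "\<dots> = x \<oplus>\<^bsub>T\<^esub> y"
      using add g_closed by (subst T.finsum_addf) auto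
    finally show ?case .
  qed
qed

end

end

subsection \<open>The Yang-Baxter equation in a unital associative algebra\<close>

locale unital_algebra = bilinear_algebra A
  for A :: "('k::{comm_ring, comm_monoid_mult}, 'a) module" (structure) +
  assumes one_closed [simp, intro]: "\<one> \<in> carrier A"
    and mult_assoc: "x \<in> carrier A \<Longrightarrow> y \<in> carrier A \<Longrightarrow> z \<in> carrier A \<Longrightarrow>
      (x \<otimes> y) \<otimes> z = x \<otimes> (y \<otimes> z)"
    and one_mult [simp]: "x \<in> carrier A \<Longrightarrow> \<one> \<otimes> x = x"
    and mult_one [simp]: "x \<in> carrier A \<Longrightarrow> x \<otimes> \<one> = x"
begin

section \<open>Double and triple tensor powers and the three legs\<close>

sublocale T2: tensor_pair A A ..

sublocale T3: tensor_pair T2.T A ..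

abbreviation "T2 \<equiv> tensor_algebra A A"
abbreviation "T3 \<equiv> tensor_algebra (tensor_algebra A A) A"

lemma pure_tensor3_eq: "pure_tensor3 A a b c = pure_tensor T2 A (pure_tensor A A a b) c"
  by (simp add: pure_tensor3_def tensor2_def)

lemma tensor3_eq: "tensor3 A = T3"
  by (simp add: tensor3_def tensor2_def)

lemma pure_tensor3_closed [simp]:
  "a \<in> carrier A \<Longrightarrow> b \<in> carrier A \<Longrightarrow> c \<in> carrier A \<Longrightarrow> pure_tensor3 A a b c \<in> carrier T3"
  by (simp add: pure_tensor3_eq)

lemma pure_tensor3_mult:
  "a \<in> carrier A \<Longrightarrow> b \<in> carrier A \<Longrightarrow> c \<in> carrier A \<Longrightarrow>
   a' \<in> carrier A \<Longrightarrow> b' \<in> carrier A \<Longrightarrow> c' \<in> carrier A \<Longrightarrow>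
   pure_tensor3 A a b c \<otimes>\<^bsub>T3\<^esub> pure_tensor3 A a' b' c' = pure_tensor3 A (a \<otimes> a') (b \<otimes> b') (c \<otimes> c')"
  by (simp add: pure_tensor3_eq T3.mult_pure T2.mult_pure)

text \<open>In the second and third leg a scalar has to cross the outer tensor sign: w \<otimes> c v
  = (c w) \<otimes> v, where \<open>w\<close> is u \<otimes> 1 or 1 \<otimes> u, and the scalar is
  then moved inside \<open>w\<close>.\<close>

lemma balanced_legs:
  "balanced_map A A T3 (\<lambda>u v. pure_tensor3 A u v \<one>)"
  "balanced_map A A T3 (\<lambda>u v. pure_tensor3 A u \<one> v)"
  "balanced_map A A T3 (\<lambda>u v. pure_tensor3 A \<one> u v)"
  by (simp_all add: balanced_map_def pure_tensor3_eq T2.pure_add_left T2.pure_add_right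
      T3.pure_add_left T3.pure_add_right T2.pure_balanced T2.smult_pure
      flip: T3.pure_balanced)

text \<open>Folding \<open>tensor3_eq\<close> makes the definition of the leg match; it is unfolded
  again because the algebra facts about the triple power are stated for \<open>T3\<close>.\<close>

lemmas leg12 = T2.tensor_eval_facts[OF T3.T.abelian_group_axioms balanced_legs(1),
    folded tensor3_eq, folded leg12_def, unfolded tensor3_eq]
lemmas leg13 = T2.tensor_eval_facts[OF T3.T.abelian_group_axioms balanced_legs(2),
    folded tensor3_eq, folded leg13_def, unfolded tensor3_eq]
lemmas leg23 = T2.tensor_eval_facts[OF T3.T.abelian_group_axioms balanced_legs(3),
    folded tensor3_eq, folded leg23_def, unfolded tensor3_eq]

section \<open>Sandwich operators\<close>

lemma bilinear_sandwich: "a \<in> carrier A \<Longrightarrow> bilinear_map A A A (\<lambda>u v. u \<otimes> a \<otimes> v)"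
  by (simp add: bilinear_map_def balanced_map_def mult_add_left mult_add_right smult_mult mult_smult)

lemma sandwich_eq:
  "a \<in> carrier A \<Longrightarrow> sandwich_operator A r a = tensor_eval A A A (\<lambda>u v. u \<otimes> a \<otimes> v) r"
  by (simp add: sandwich_operator_def)

lemma balanced_sandwich: "a \<in> carrier A \<Longrightarrow> balanced_map A A A (\<lambda>u v. u \<otimes> a \<otimes> v)"
  using bilinear_sandwich by (simp add: bilinear_map_def)

lemma sandwich_pure [simp]:
  "u \<in> carrier A \<Longrightarrow> v \<in> carrier A \<Longrightarrow> a \<in> carrier A \<Longrightarrow>
    sandwich_operator A (pure_tensor A A u v) a = u \<otimes> a \<otimes> v"
  by (simp add: sandwich_eq T2.tensor_eval_pure[OF abelian_group_axioms balanced_sandwich])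

lemma sandwich_closed [simp]:
  "r \<in> carrier T2 \<Longrightarrow> a \<in> carrier A \<Longrightarrow> sandwich_operator A r a \<in> carrier A"
  by (simp add: sandwich_eq T2.tensor_eval_closed[OF abelian_group_axioms balanced_sandwich])

lemma sandwich_add [simp]:
  "r \<in> carrier T2 \<Longrightarrow> r' \<in> carrier T2 \<Longrightarrow> a \<in> carrier A \<Longrightarrow>
    sandwich_operator A (r \<oplus>\<^bsub>T2\<^esub> r') a = sandwich_operator A r a \<oplus> sandwich_operator A r' a"
  by (simp add: sandwich_eq T2.tensor_eval_add[OF abelian_group_axioms balanced_sandwich])

lemma sandwich_smult [simp]:
  "r \<in> carrier T2 \<Longrightarrow> a \<in> carrier A \<Longrightarrow>
    sandwich_operator A (k \<odot>\<^bsub>T2\<^esub> r) a = k \<odot> sandwich_operator A r a"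
  by (simp add: sandwich_eq T2.tensor_eval_smult[OF bilinear_algebra_axioms bilinear_sandwich])

lemma sandwich_arg_add:
  assumes "r \<in> carrier T2" "a \<in> carrier A" "b \<in> carrier A"
  shows "sandwich_operator A r (a \<oplus> b) = sandwich_operator A r a \<oplus> sandwich_operator A r b"
  using assms
  by (induction r rule: T2.tensor_induct) (simp_all add: mult_add_left mult_add_right a_ac)

lemma sandwich_arg_smult:
  assumes "r \<in> carrier T2" "a \<in> carrier A"
  shows "sandwich_operator A r (k \<odot> a) = k \<odot> sandwich_operator A r a"
  using assms
  by (induction r rule: T2.tensor_induct) (simp_all add: smult_mult mult_smult smult_add_right)

lemma sandwich_linear_endo:
  assumes "r \<in> carrier T2"
  shows "sandwich_operator A r \<in> linear_endos A"
proof -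
  have "sandwich_operator A r \<in> carrier A \<rightarrow>\<^sub>E carrier A"
    using assms by (intro PiE_I) (simp, simp add: sandwich_operator_def)
  then show ?thesis
    using assms by (simp add: linear_endos_def sandwich_arg_add sandwich_arg_smult)
qed

text \<open>The map \<Phi> of the introduction for the pair \<open>a\<close>, \<open>b\<close>. The
  two inner factors are absorbed by the sandwich operator, so linearity in \<open>w\<close> comes
  from \<open>sandwich_add\<close> and \<open>sandwich_smult\<close>.\<close>

definition double_sandwich :: "'a \<Rightarrow> 'a \<Rightarrow> 'a tensor3 \<Rightarrow> 'a" where
  "double_sandwich a b = tensor_eval T2 A A (\<lambda>w z. sandwich_operator A w a \<otimes> b \<otimes> z)"

lemma bilinear_double_sandwich:
  "a \<in> carrier A \<Longrightarrow> b \<in> carrier A \<Longrightarrow>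
    bilinear_map T2 A A (\<lambda>w z. sandwich_operator A w a \<otimes> b \<otimes> z)"
  by (simp add: bilinear_map_def balanced_map_def mult_add_left mult_add_right smult_mult mult_smult)

lemma balanced_double_sandwich:
  "a \<in> carrier A \<Longrightarrow> b \<in> carrier A \<Longrightarrow>
    balanced_map T2 A A (\<lambda>w z. sandwich_operator A w a \<otimes> b \<otimes> z)"
  using bilinear_double_sandwich by (simp add: bilinear_map_def)

lemmas double_sandwich =
  T3.tensor_eval_facts[OF abelian_group_axioms balanced_double_sandwich, folded double_sandwich_def]

lemma double_sandwich_pure3:
  "a \<in> carrier A \<Longrightarrow> b \<in> carrier A \<Longrightarrow> x \<in> carrier A \<Longrightarrow> y \<in> carrier A \<Longrightarrow> z \<in> carrier A \<Longrightarrow>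
    double_sandwich a b (pure_tensor3 A x y z) = x \<otimes> a \<otimes> y \<otimes> b \<otimes> z"
  by (simp add: pure_tensor3_eq double_sandwich)

lemma double_sandwich_smult:
  "a \<in> carrier A \<Longrightarrow> b \<in> carrier A \<Longrightarrow> t \<in> carrier T3 \<Longrightarrow>
    double_sandwich a b (k \<odot>\<^bsub>T3\<^esub> t) = k \<odot> double_sandwich a b t"
  unfolding double_sandwich_def
  by (rule T3.tensor_eval_smult[OF bilinear_algebra_axioms bilinear_double_sandwich])

lemma double_sandwich_uminus:
  "a \<in> carrier A \<Longrightarrow> b \<in> carrier A \<Longrightarrow> t \<in> carrier T3 \<Longrightarrow>
    double_sandwich a b (\<ominus>\<^bsub>T3\<^esub> t) = \<ominus> double_sandwich a b t"
  using T3.T.additive_map_uminus[OF abelian_group_axioms, of "double_sandwich a b" t]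
  by (simp add: double_sandwich)

section \<open>Images of the terms of the Yang-Baxter equation\<close>

context
  fixes a b assumes ab [simp]: "a \<in> carrier A" "b \<in> carrier A"
begin

lemmas induct_simps = leg12 leg13 leg23 double_sandwich double_sandwich_pure3 pure_tensor3_mult
  T3.T.mult_add_left T3.T.mult_add_right mult_add_left mult_add_right sandwich_arg_add a_ac mult_assoc

text \<open>For r = u \<otimes> v and s = u' \<otimes> v' the product of legs is u u' \<otimes> v'
  \<otimes> v, with image u (u' a v' b) v. Two independent tensors are taken although only r = s is
  wanted: the claim is additive in each of them, whereas for r = s it is quadratic and out of reach
  of the induction.\<close>

lemma double_sandwich_leg13_leg12:
  assumes r: "r \<in> carrier T2" and s: "s \<in> carrier T2"
  shows "double_sandwich a b (leg13 A r \<otimes>\<^bsub>T3\<^esub> leg12 A s)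
    = sandwich_operator A r (sandwich_operator A s a \<otimes> b)"
  using r
proof (induction r rule: T2.tensor_induct)
  case (pure u v)
  from s show ?case
    by (induction s rule: T2.tensor_induct) (simp_all add: pure induct_simps)
qed (simp add: s induct_simps)

text \<open>On pure tensors the product is u \<otimes> v u' \<otimes> v', with image (u a v) (u' b
  v').\<close>

lemma double_sandwich_leg12_leg23:
  assumes r: "r \<in> carrier T2" and s: "s \<in> carrier T2"
  shows "double_sandwich a b (leg12 A r \<otimes>\<^bsub>T3\<^esub> leg23 A s)
    = sandwich_operator A r a \<otimes> sandwich_operator A s b"
  using r
proof (induction r rule: T2.tensor_induct)
  case (pure u v)
  from s show ?case
    by (induction s rule: T2.tensor_induct) (simp_all add: pure induct_simps)
qed (simp add: s induct_simps)

text \<open>On pure tensors the product is u' \<otimes> u \<otimes> v v', with image u' (a u b v)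
  v'. Thus the operator of the right factor \<open>s\<close> ends up outside.\<close>

lemma double_sandwich_leg23_leg13:
  assumes r: "r \<in> carrier T2" and s: "s \<in> carrier T2"
  shows "double_sandwich a b (leg23 A r \<otimes>\<^bsub>T3\<^esub> leg13 A s)
    = sandwich_operator A s (a \<otimes> sandwich_operator A r b)"
  using r
proof (induction r rule: T2.tensor_induct)
  case (pure u v)
  from s show ?case
    by (induction s rule: T2.tensor_induct) (simp_all add: pure induct_simps)
qed (simp add: s induct_simps)

lemma double_sandwich_leg13:
  assumes r: "r \<in> carrier T2"
  shows "double_sandwich a b (leg13 A r) = sandwich_operator A r (a \<otimes> b)"
  using r by (induction r rule: T2.tensor_induct) (simp_all add: induct_simps)

end

text \<open>The four computations above translate the image of the Yang-Baxter equation under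
  \<open>double_sandwich a b\<close> into the Rota-Baxter equation at \<open>a\<close> and
  \<open>b\<close>. The assumption \<open>separating\<close> leads back from these equations in
  \<open>A\<close> to the single equation in the triple power; it isolates what is later verified
  for matrices.\<close>

lemma aybe_iff_rota_baxter:
  assumes r: "r \<in> carrier T2"
    and separating: "\<And>t t'. t \<in> carrier T3 \<Longrightarrow> t' \<in> carrier T3 \<Longrightarrow>
      (\<And>a b. a \<in> carrier A \<Longrightarrow> b \<in> carrier A \<Longrightarrow> double_sandwich a b t = double_sandwich a b t') \<Longrightarrow>
      t = t'"
  shows "r \<in> aybe_solutions A lam \<longleftrightarrow> sandwich_operator A r \<in> rota_baxter_operators A (- lam)"
proof -
  let ?P = "sandwich_operator A r"
  let ?l = "leg13 A r \<otimes>\<^bsub>T3\<^esub> leg12 A r \<ominus>\<^bsub>T3\<^esub> leg12 A r \<otimes>\<^bsub>T3\<^esub> leg23 A r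
    \<oplus>\<^bsub>T3\<^esub> leg23 A r \<otimes>\<^bsub>T3\<^esub> leg13 A r"
  let ?r = "lam \<odot>\<^bsub>T3\<^esub> leg13 A r"
  have legs [simp]: "leg12 A r \<in> carrier T3" "leg13 A r \<in> carrier T3" "leg23 A r \<in> carrier T3"
    using r by (simp_all add: leg12 leg13 leg23)
  have uminus_smult: "(- k) \<odot> x = \<ominus> (k \<odot> x)" if "x \<in> carrier A" for k x
  proof -
    \<comment> \<open>Scaling a fixed \<open>x\<close> is an additive map out of
      \<open>scalar_module\<close>, so it preserves zero.\<close>
    have "0 \<odot> x = \<zero>"
      using scalar.additive_map_zero[OF abelian_group_axioms, of "\<lambda>k. k \<odot> x"] that
      by (simp add: smult_add_left)
    then show ?thesis
      using smult_add_left[OF that, of "- k" k] that by (simp add: minus_equality)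
  qed
  \<comment> \<open>Here the sign of the weight changes: isolating the product term \<open>y\<close>
    puts \<open>l\<close> on the other side with a minus sign. The proof adds
    \<open>y \<ominus> l\<close> to both sides.\<close>
  have rearrange: "x \<ominus> y \<oplus> z = l \<longleftrightarrow> y = z \<oplus> x \<oplus> \<ominus> l"
    if "x \<in> carrier A" "y \<in> carrier A" "z \<in> carrier A" "l \<in> carrier A" for x y z l
  proof -
    have "x \<ominus> y \<oplus> z = l \<longleftrightarrow> (x \<ominus> y \<oplus> z) \<oplus> (y \<ominus> l) = l \<oplus> (y \<ominus> l)"
      using that by (simp add: minus_closed)
    also have "(x \<ominus> y \<oplus> z) \<oplus> (y \<ominus> l) = (\<ominus> y \<oplus> y) \<oplus> (z \<oplus> x \<oplus> \<ominus> l)"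
      using that by (simp add: a_minus_def a_ac)
    also have "\<dots> = z \<oplus> x \<oplus> \<ominus> l"
      using that by (simp add: l_neg)
    also have "l \<oplus> (y \<ominus> l) = (\<ominus> l \<oplus> l) \<oplus> y"
      using that by (simp add: a_minus_def a_ac)
    also have "\<dots> = y"
      using that by (simp add: l_neg)
    finally show ?thesis by auto
  qed
  have eqn: "double_sandwich a b ?l = double_sandwich a b ?r \<longleftrightarrow>
      ?P a \<otimes> ?P b = ?P (a \<otimes> ?P b) \<oplus> ?P (?P a \<otimes> b) \<oplus> (- lam) \<odot> ?P (a \<otimes> b)"
    if "a \<in> carrier A" "b \<in> carrier A" for a b
  proof -
    have "double_sandwich a b ?l = ?P (?P a \<otimes> b) \<ominus> ?P a \<otimes> ?P b \<oplus> ?P (a \<otimes> ?P b)"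
      using that r
      by (simp add: double_sandwich a_minus_def double_sandwich_uminus double_sandwich_leg13_leg12
          double_sandwich_leg12_leg23 double_sandwich_leg23_leg13)
    moreover have "double_sandwich a b ?r = lam \<odot> ?P (a \<otimes> b)"
      using that r by (simp add: double_sandwich_smult double_sandwich_leg13)
    ultimately show ?thesis
      using that r by (simp add: rearrange uminus_smult)
  qed
  have "r \<in> aybe_solutions A lam \<longleftrightarrow> ?l = ?r"
    using r by (simp add: aybe_solutions_def tensor3_eq) (simp add: tensor2_def)
  also have "\<dots> \<longleftrightarrow> (\<forall>a \<in> carrier A. \<forall>b \<in> carrier A. double_sandwich a b ?l = double_sandwich a b ?r)"
    using separating[of ?l ?r] by (auto simp: T3.T.minus_closed)
  also have "\<dots> \<longleftrightarrow> ?P \<in> rota_baxter_operators A (- lam)"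
    using sandwich_linear_endo[OF r] by (simp add: rota_baxter_operators_def eqn)
  finally show ?thesis .
qed

end

subsection \<open>Matrices\<close>

lemma mat_algebra_simps [simp]:
  "carrier (mat_algebra n) = carrier_mat n n" "add (mat_algebra n) = (+)"
  "mult (mat_algebra n) = (*)" "one (mat_algebra n) = 1\<^sub>m n"
  "ring.zero (mat_algebra n) = 0\<^sub>m n n" "smult (mat_algebra n) = (\<cdot>\<^sub>m)"
  by (simp_all add: mat_algebra_def)

section \<open>Entries of products with matrix units\<close>

lemma index_mult_mat_sum:
  "X \<in> carrier_mat n n \<Longrightarrow> Y \<in> carrier_mat n n \<Longrightarrow> p < n \<Longrightarrow> q < n \<Longrightarrow>
    (X * Y) $$ (p, q) = (\<Sum>k<n. X $$ (p, k) * Y $$ (k, q))"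
  by (simp add: scalar_prod_def lessThan_atLeast0)

definition mat_unit :: "nat \<Rightarrow> nat \<times> nat \<Rightarrow> 'k::{zero, one} mat" where
  "mat_unit n s = mat n n (\<lambda>t. if t = s then 1 else 0)"

lemma mat_unit_closed [simp]: "mat_unit n s \<in> carrier_mat n n"
  by (simp add: mat_unit_def)

lemma index_mat_unit [simp]:
  "p < n \<Longrightarrow> q < n \<Longrightarrow> mat_unit n s $$ (p, q) = (if (p, q) = s then 1 else 0)"
  by (simp add: mat_unit_def)

context
  fixes X :: "'k::{comm_ring, comm_monoid_mult} mat" and n p q :: nat
  assumes X: "X \<in> carrier_mat n n" and pq: "p < n" "q < n"
begin

lemma index_mat_unit_mult:
  assumes "j < n"
  shows "(mat_unit n (i, j) * X) $$ (p, q) = (if p = i then X $$ (j, q) else 0)"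
proof -
  have "(mat_unit n (i, j) * X) $$ (p, q) =
    (\<Sum>k<n. if k = j then (if p = i then X $$ (j, q) else 0) else 0)"
    unfolding index_mult_mat_sum[OF mat_unit_closed X pq] using pq by (intro sum.cong) auto
  then show ?thesis using assms by simp
qed

lemma index_mult_mat_unit:
  assumes "i < n"
  shows "(X * mat_unit n (i, j)) $$ (p, q) = (if q = j then X $$ (p, i) else 0)"
proof -
  have "(X * mat_unit n (i, j)) $$ (p, q) =
    (\<Sum>k<n. if k = i then (if q = j then X $$ (p, i) else 0) else 0)"
    unfolding index_mult_mat_sum[OF X mat_unit_closed pq] using pq
    by (intro sum.cong) (auto simp: mult.commute[of _ 1])
  then show ?thesis using assms by simp
qed

text \<open>The scalars may satisfy 0 = 1, so the unit laws are read off entry by entry from the sum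
  formula.\<close>

lemma one_mult_mat: "(1\<^sub>m n * X) $$ (p, q) = X $$ (p, q)" "(X * 1\<^sub>m n) $$ (p, q) = X $$ (p, q)"
proof -
  have "(1\<^sub>m n * X) $$ (p, q) = (\<Sum>k<n. if k = p then X $$ (p, q) else 0)"
    unfolding index_mult_mat_sum[OF one_carrier_mat X pq] using pq by (intro sum.cong) auto
  then show "(1\<^sub>m n * X) $$ (p, q) = X $$ (p, q)" using pq by simp
  have "(X * 1\<^sub>m n) $$ (p, q) = (\<Sum>k<n. if k = q then X $$ (p, q) else 0)"
    unfolding index_mult_mat_sum[OF X one_carrier_mat pq] using pq by (intro sum.cong) auto
  then show "(X * 1\<^sub>m n) $$ (p, q) = X $$ (p, q)" using pq by simp
qed

end

lemma index_mult_mat_unit_mult: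
  fixes X Y :: "'k::{comm_ring, comm_monoid_mult} mat"
  assumes X: "X \<in> carrier_mat n n" and Y: "Y \<in> carrier_mat n n"
    and "p < n" "q < n" "i < n" "j < n"
  shows "(X * mat_unit n (i, j) * Y) $$ (p, q) = X $$ (p, i) * Y $$ (j, q)"
proof -
  have "(X * mat_unit n (i, j) * Y) $$ (p, q)
      = (\<Sum>k<n. if k = j then X $$ (p, i) * Y $$ (j, q) else 0)"
    unfolding index_mult_mat_sum[OF mult_carrier_mat[OF X mat_unit_closed] Y assms(3,4)]
    using assms by (intro sum.cong) (auto simp: index_mult_mat_unit simp del: index_mult_mat)
  then show ?thesis using assms by simp
qed

interpretation mat: unital_algebra "mat_algebra n :: ('k::{comm_ring, comm_monoid_mult}, 'k mat) module"
  for n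
proof (intro unital_algebra.intro bilinear_algebra.intro abelian_groupI)
  fix x :: "'k mat" assume "x \<in> carrier (mat_algebra n)"
  then show "\<exists>y \<in> carrier (mat_algebra n). y \<oplus>\<^bsub>mat_algebra n\<^esub> x = \<zero>\<^bsub>mat_algebra n\<^esub>"
    by (intro bexI[of _ "- x"]) (auto intro: eq_matI)
next
  show "bilinear_algebra_axioms (mat_algebra n :: ('k, 'k mat) module)"
    by unfold_locales
      (auto simp: add_mult_distrib_mat mult_add_distrib_mat add_smult_distrib_left_mat
        add_smult_distrib_right_mat mult_smult_distrib mult_smult_assoc_mat mult.assoc intro!: eq_matI)
next
  show "unital_algebra_axioms (mat_algebra n :: ('k, 'k mat) module)"
    by unfold_locales (auto intro!: eq_matI simp: one_mult_mat simp del: index_mult_mat(1))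
qed (auto simp: comm_add_mat intro: add_carrier_mat)

lemma index_finsum_mat:
  fixes f :: "'i \<Rightarrow> 'k::{comm_ring, comm_monoid_mult} mat"
  assumes "f \<in> I \<rightarrow> carrier_mat n n" "p < n" "q < n"
  shows "finsum (mat_algebra n) f I $$ (p, q) = (\<Sum>i\<in>I. f i $$ (p, q))"
  using mat.additive_map_finsum[OF scalar.abelian_group_axioms, of n "\<lambda>x. x $$ (p, q)" f I] assms
  by (simp add: finsum_scalar_module)

abbreviation "mat_index n \<equiv> {..<n} \<times> {..<n::nat}"

lemma mat_frame:
  "coordinate_frame (mat_algebra n :: ('k::{comm_ring, comm_monoid_mult}, 'k mat) module)
    (mat_index n) (mat_unit n) (\<lambda>s x. x $$ s)"
proof
  fix x :: "'k mat" assume x: "x \<in> carrier (mat_algebra n)"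
  show "(\<Oplus>\<^bsub>mat_algebra n\<^esub>s\<in>mat_index n. x $$ s \<odot>\<^bsub>mat_algebra n\<^esub> mat_unit n s) = x"
    (is "?s = x")
  proof (rule eq_matI)
    have s: "?s \<in> carrier (mat_algebra n)" by (rule mat.finsum_closed) simp
    then show "dim_row ?s = dim_row x" "dim_col ?s = dim_col x" using x by auto
    fix p q assume "p < dim_row x" "q < dim_col x"
    then have pq: "p < n" "q < n" using x by auto
    have "?s $$ (p, q) = (\<Sum>s\<in>mat_index n. (x $$ s \<odot>\<^bsub>mat_algebra n\<^esub> mat_unit n s) $$ (p, q))"
      using pq by (intro index_finsum_mat) auto
    also have "\<dots> = (\<Sum>s\<in>mat_index n. if s = (p, q) then x $$ (p, q) else 0)"
      using pq by (intro sum.cong) (auto simp: mat_unit_def mult.commute[of _ 1])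
    finally have "?s $$ (p, q) = (\<Sum>s\<in>mat_index n. if s = (p, q) then x $$ (p, q) else 0)" .
    then show "?s $$ (p, q) = x $$ (p, q)" using pq by simp
  qed
qed auto

section \<open>Sandwich operators in coordinates\<close>

abbreviation mat_coord2 where "mat_coord2 n \<equiv>
  mat.T2.tensor_coord n (\<lambda>s x. x $$ s) (\<lambda>s x. x $$ s)"

text \<open>Both sides are additive in \<open>r\<close>, and on u \<otimes> v both are the product
  of the entries of \<open>u\<close> at (p, j) and of \<open>v\<close> at (k, q). Every coordinate
  of \<open>r\<close> is obtained in this way, whence injectivity.\<close>

lemma index_sandwich:
  fixes r :: "'k::{comm_ring, comm_monoid_mult} mat tensor2"
  assumes "r \<in> carrier (tensor_algebra (mat_algebra n) (mat_algebra n))"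
    and "p < n" "j < n" "k < n" "q < n"
  shows "sandwich_operator (mat_algebra n) r (mat_unit n (j, k)) $$ (p, q)
    = mat_coord2 n ((p, j), (k, q)) r"
  using assms(1)
proof (induction r rule: mat.T2.tensor_induct)
  case (pure u v)
  with assms show ?case
    using mat.T2.tensor_coord_pure[OF mat_frame mat_frame, of "(p, j)" n "(k, q)" u v]
    by (simp add: index_mult_mat_unit_mult del: index_mult_mat)
next
  case (add x y)
  with assms show ?case
    using mat.T2.tensor_coord_add[OF mat_frame mat_frame, of "(p, j)" n "(k, q)" x y]
      mat.sandwich_closed[OF add.hyps(1), of "mat_unit n (j, k)"]
      mat.sandwich_closed[OF add.hyps(2), of "mat_unit n (j, k)"]
    by simp
qed

text \<open>On w \<otimes> z the left side is the (p, l) entry of the sandwich operator of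
  \<open>w\<close> at the matrix unit (j, k), times the entry of \<open>z\<close> at (m, q). By
  \<open>index_sandwich\<close> the first factor is itself a coordinate of \<open>w\<close>.\<close>

lemma index_double_sandwich:
  fixes t :: "'k::{comm_ring, comm_monoid_mult} mat tensor3"
  assumes "t \<in> carrier (tensor_algebra (tensor_algebra (mat_algebra n) (mat_algebra n)) (mat_algebra n))"
    and "p < n" "j < n" "k < n" "l < n" "m < n" "q < n"
  shows "mat.double_sandwich n (mat_unit n (j, k)) (mat_unit n (l, m)) t $$ (p, q)
    = mat.T3.tensor_coord n (mat_coord2 n) (\<lambda>s x. x $$ s) (((p, j), (k, l)), (m, q)) t"
  using assms(1)
proof (induction t rule: mat.T3.tensor_induct)
  case (pure w z)
  with assms show ?case
    using mat.T3.tensor_coord_pure[OF mat.T2.tensor_frame[OF mat_frame mat_frame] mat_frame,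
        of "((p, j), (k, l))" n "(m, q)" w z]
      mat.sandwich_closed[OF pure(1), of "mat_unit n (j, k)"]
    by (simp add: mat.double_sandwich index_mult_mat_unit_mult index_sandwich del: index_mult_mat)
next
  case (add x y)
  with assms show ?case
    using mat.T3.tensor_coord_add[OF mat.T2.tensor_frame[OF mat_frame mat_frame] mat_frame,
        of "((p, j), (k, l))" n "(m, q)" x y]
      mat.double_sandwich(2)[of "mat_unit n (j, k)" n "mat_unit n (l, m)" x]
      mat.double_sandwich(2)[of "mat_unit n (j, k)" n "mat_unit n (l, m)" y]
    by (simp add: mat.double_sandwich)
qed

lemma inj_on_sandwich:
  "inj_on (sandwich_operator (mat_algebra n :: ('k::{comm_ring, comm_monoid_mult}, 'k mat) module))
    (carrier (tensor_algebra (mat_algebra n) (mat_algebra n)))"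
proof (rule inj_onI)
  fix r r' :: "'k mat tensor2"
  assume r: "r \<in> carrier (tensor_algebra (mat_algebra n) (mat_algebra n))"
    "r' \<in> carrier (tensor_algebra (mat_algebra n) (mat_algebra n))"
    and eq: "sandwich_operator (mat_algebra n) r = sandwich_operator (mat_algebra n) r'"
  show "r = r'"
  proof (rule coordinate_frame.coord_eqI[OF mat.T2.tensor_frame[OF mat_frame mat_frame] r])
    fix s assume "s \<in> mat_index n \<times> mat_index n"
    then show "mat_coord2 n s r = mat_coord2 n s r'"
      using r eq by (auto simp flip: index_sandwich)
  qed
qed

text \<open>Matrix units for \<open>a\<close> and \<open>b\<close> already suffice: the entries of
  the resulting matrices run through all coordinates of the triple tensor.\<close>

lemma double_sandwich_separating:
  fixes t t' :: "'k::{comm_ring, comm_monoid_mult} mat tensor3"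
  assumes t: "t \<in> carrier (tensor_algebra (tensor_algebra (mat_algebra n) (mat_algebra n)) (mat_algebra n))"
    "t' \<in> carrier (tensor_algebra (tensor_algebra (mat_algebra n) (mat_algebra n)) (mat_algebra n))"
    and eq: "\<And>a b. a \<in> carrier (mat_algebra n) \<Longrightarrow> b \<in> carrier (mat_algebra n) \<Longrightarrow>
      mat.double_sandwich n a b t = mat.double_sandwich n a b t'"
  shows "t = t'"
proof (rule coordinate_frame.coord_eqI[OF
      mat.T3.tensor_frame[OF mat.T2.tensor_frame[OF mat_frame mat_frame] mat_frame] t])
  fix s assume "s \<in> (mat_index n \<times> mat_index n) \<times> mat_index n"
  then show "mat.T3.tensor_coord n (mat_coord2 n) (\<lambda>s x. x $$ s) s t
      = mat.T3.tensor_coord n (mat_coord2 n) (\<lambda>s x. x $$ s) s t'"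
    using t eq by (auto simp flip: index_double_sandwich)
qed

section \<open>Every linear endomorphism is a sandwich operator\<close>

lemma linear_endo_sandwich:
  fixes P :: "'k::{comm_ring, comm_monoid_mult} mat \<Rightarrow> 'k mat"
  assumes P: "P \<in> linear_endos (mat_algebra n)"
  shows "P \<in> sandwich_operator (mat_algebra n) ` carrier (tensor_algebra (mat_algebra n) (mat_algebra n))"
proof -
  let ?A = "mat_algebra n :: ('k, 'k mat) module"
  let ?E = "mat_unit n :: nat \<times> nat \<Rightarrow> 'k mat"
  have P_closed: "P x \<in> carrier_mat n n" if "x \<in> carrier_mat n n" for x
    using P that by (auto simp: linear_endos_def)
  define g where "g s p = pure_tensor ?A ?A (?E (p, fst s)) (?E (snd s, p) * P (?E s))" for s p
  \<comment> \<open>\<open>\<Sum>\<^sub>p E\<^sub>p\<^sub>j a E\<^sub>k\<^sub>p X = a\<^sub>j\<^sub>k X\<close>, and \<open>P a\<close> is the sum of the \<open>a\<^sub>j\<^sub>k P(E\<^sub>j\<^sub>k)\<close>.\<close>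
  define r where "r = (\<Oplus>\<^bsub>mat.T2 n\<^esub>s\<in>mat_index n. \<Oplus>\<^bsub>mat.T2 n\<^esub>p\<in>{..<n}. g s p)"
  have g: "g s p \<in> carrier (mat.T2 n)" for s p
    unfolding g_def using P_closed by (intro mat.T2.pure_closed) (auto intro!: mult_carrier_mat[of _ n n])
  then have r: "r \<in> carrier (mat.T2 n)"
    unfolding r_def by (intro mat.T2.T.finsum_closed) (auto intro: mat.T2.T.finsum_closed)
  have "sandwich_operator ?A r a = P a" if a: "a \<in> carrier_mat n n" for a
  proof (rule eq_matI)
    have Pa: "P a \<in> carrier_mat n n" and ra: "sandwich_operator ?A r a \<in> carrier_mat n n"
      using P_closed[OF a] mat.sandwich_closed[OF r, of a] a by auto
    then show "dim_row (sandwich_operator ?A r a) = dim_row (P a)"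
      "dim_col (sandwich_operator ?A r a) = dim_col (P a)" by auto
    fix p q assume "p < dim_row (P a)" "q < dim_col (P a)"
    then have pq: "p < n" "q < n" using Pa by auto
    have sandwich_finsum: "sandwich_operator ?A (finsum (mat.T2 n) f J) a
        = (\<Oplus>\<^bsub>?A\<^esub>i\<in>J. sandwich_operator ?A (f i) a)"
      if "f \<in> J \<rightarrow> carrier (mat.T2 n)" for f and J :: "'z set"
      by (rule mat.T2.T.additive_map_finsum[OF mat.abelian_group_axioms,
            where h = "\<lambda>r. sandwich_operator ?A r a"])
        (use a that mat.sandwich_closed[of _ n a] in auto)
    have sandwich_g: "sandwich_operator ?A (g s i) a
        = ?E (i, fst s) * a * (?E (snd s, i) * P (?E s))" for s i
      unfolding g_def using a P_closed[of "?E s"] by (subst mat.sandwich_pure)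
        (auto intro!: mult_carrier_mat[of _ n n])
    have index_g: "sandwich_operator ?A (g s i) a $$ (p, q)
        = (if i = p then a $$ s * P (?E s) $$ (p, q) else 0)"
      if si: "s \<in> mat_index n" "i < n" for s i
    proof -
      obtain j k where s: "s = (j, k)" "j < n" "k < n" using si by auto
      \<comment> \<open>With the matrix unit (i, j) in front, only row \<open>i\<close> of the
        product is nonzero. That row is row \<open>j\<close> of the bracket, whose middle unit (k,
        i) extracts the entry of \<open>a\<close> at (j, k) and row \<open>i\<close> of
        \<open>P (?E s)\<close>.\<close>
      have "sandwich_operator ?A (g s i) a = ?E (i, j) * (a * ?E (k, i) * P (?E s))"
        unfolding sandwich_g s fst_conv snd_conv using a P_closed[of "?E s"] s
        by (simp add: assoc_mult_mat[of _ n n _ n _ n] mult_carrier_mat[of _ n n])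
      then show ?thesis
        using s a pq si P_closed[of "?E s"]
        by (simp add: index_mat_unit_mult index_mult_mat_unit_mult mult_carrier_mat[of _ n n] del: index_mult_mat)
    qed
    have closed_g: "sandwich_operator ?A (g s i) a \<in> carrier_mat n n" for s i
      using mat.sandwich_closed[OF g, of a] a by auto
    have closed_sum: "(\<Oplus>\<^bsub>?A\<^esub>i\<in>{..<n}. sandwich_operator ?A (g s i) a) \<in> carrier_mat n n" for s
      using mat.finsum_closed[of "\<lambda>i. sandwich_operator ?A (g s i) a" "{..<n}" n] closed_g by simp
    have index_smult: "(k \<cdot>\<^sub>m P (?E s)) $$ (p, q) = k * P (?E s) $$ (p, q)" for k s
      using pq P_closed[OF mat_unit_closed, of s] by auto
    have "sandwich_operator ?A r a
        = (\<Oplus>\<^bsub>?A\<^esub>s\<in>mat_index n. \<Oplus>\<^bsub>?A\<^esub>i\<in>{..<n}. sandwich_operator ?A (g s i) a)"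
      unfolding r_def using g by (simp add: sandwich_finsum mat.T2.T.finsum_closed)
    then have "sandwich_operator ?A r a $$ (p, q)
        = (\<Sum>s\<in>mat_index n. \<Sum>i<n. sandwich_operator ?A (g s i) a $$ (p, q))"
      using pq closed_g closed_sum by (simp add: index_finsum_mat)
    \<comment> \<open>In the inner sum only the term i = p survives, by
      \<open>index_g\<close>.\<close>
    also have "\<dots> = (\<Sum>s\<in>mat_index n. a $$ s * P (?E s) $$ (p, q))"
      using pq by (intro sum.cong refl) (simp add: index_g)
    also have "\<dots> = (\<Oplus>\<^bsub>?A\<^esub>s\<in>mat_index n. P (a $$ s \<cdot>\<^sub>m ?E s)) $$ (p, q)"
      using pq P P_closed index_smult by (subst index_finsum_mat)
        (auto simp: linear_endos_def intro!: sum.cong)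
    \<comment> \<open>Additivity of \<open>P\<close> pulls it out of the sum, which is then the
      expansion of \<open>a\<close> in matrix units.\<close>
    also have "(\<Oplus>\<^bsub>?A\<^esub>s\<in>mat_index n. P (a $$ s \<cdot>\<^sub>m ?E s)) = P a"
      using mat.additive_map_finsum[OF mat.abelian_group_axioms, of n P n
          "\<lambda>s. a $$ s \<cdot>\<^sub>m ?E s" "mat_index n"]
        coordinate_frame.expansion[OF mat_frame, of a n] a P P_closed
      by (simp add: linear_endos_def)
    finally show "sandwich_operator ?A r a $$ (p, q) = P a $$ (p, q)" .
  qed
  \<comment> \<open>Both functions are \<open>undefined\<close> off the carrier, so agreement on
    matrices of size n makes them equal.\<close>
  moreover have "sandwich_operator ?A r \<in> extensional (carrier_mat n n)"
    by (simp add: sandwich_operator_def)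
  moreover have "P \<in> extensional (carrier_mat n n)"
    using P by (simp add: linear_endos_def PiE_def)
  ultimately have "sandwich_operator ?A r = P"
    by (intro extensionalityI[of _ "carrier_mat n n"])
  with r show ?thesis by blast
qed

theorem theorem1p2:
  fixes lam :: "'k::{comm_ring, comm_monoid_mult}" and n :: nat
  assumes "n \<ge> 1"
  shows "bij_betw (sandwich_operator (mat_algebra n))
           (aybe_solutions (mat_algebra n) lam)
           (rota_baxter_operators (mat_algebra n) (- lam))"
proof -
  let ?A = "mat_algebra n :: ('k, 'k mat) module"
  let ?S = "carrier (tensor_algebra ?A ?A)"
  have aybe: "aybe_solutions ?A lam \<subseteq> ?S"
    by (auto simp: aybe_solutions_def tensor2_def)
  have iff: "r \<in> aybe_solutions ?A lam \<longleftrightarrow> sandwich_operator ?A r \<in> rota_baxter_operators ?A (- lam)"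
    if "r \<in> ?S" for r
    using that double_sandwich_separating by (rule mat.aybe_iff_rota_baxter)
  have "rota_baxter_operators ?A (- lam) \<subseteq> sandwich_operator ?A ` ?S"
    using linear_endo_sandwich by (auto simp: rota_baxter_operators_def)
  \<comment> \<open>Each Rota-Baxter operator comes from some tensor because it is linear;
    \<open>iff\<close> shows that this tensor is a solution, and conversely that solutions are sent
    to Rota-Baxter operators.\<close>
  then have "sandwich_operator ?A ` aybe_solutions ?A lam = rota_baxter_operators ?A (- lam)"
    using aybe iff by blast
  then show ?thesis
    using inj_on_subset[OF inj_on_sandwich aybe] by (simp add: bij_betw_def)
qed

end
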